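(* Let $1\le p<\infty$, $\alpha>-1$, let $u$ be an analytic function on the open unit disk $\mathbb{D}$ and $\varphi$ an analytic self-map of $\mathbb{D}$. Then the weighted composition operator $uC_\varphi:A^p_\alpha\to\mathcal{B}$ is bounded if and only if $$\sup_{j\ge1}j^{(2+\alpha)/p}\|I_u(\varphi^j)\|_{\mathcal{B}}<\infty\quad\text{and}\quad\sup_{j\ge1}j^{(2+\alpha)/p}\|J_u(\varphi^{j-1})\|_{\mathcal{B}}<\infty,$$ where, for $g$ analytic on $\mathbb{D}$ and $z\in\mathbb{D}$, $$I_ug(z)=\int_0^zg'(\xi)u(\xi)\,d\xi,\qquad J_ug(z)=\int_0^zg(\xi)u'(\xi)\,d\xi.$$
   Context: $H(\mathbb{D})$ is the space of analytic functions on the open unit disk $\mathbb{D}\subset\mathbb{C}$. For $u\in H(\mathbb{D})$ and an analytic $\varphi:\mathbb{D}\to\mathbb{D}$, the weighted composition operator is $(uC_\varphi f)(z)=u(z)f(\varphi(z))$, $f\in H(\mathbb{D})$. The weighted Bergman space $A^p_\alpha$ consists of all $f\in H(\mathbb{D})$ with $\|f\|_{A^p_\alpha}^p=(\alpha+1)\int_{\mathbb{D}}|f(z)|^p(1-|z|^2)^\alpha\,dA(z)<\infty$, where $dA$ is Lebesgue area measure normalized so that $A(\mathbb{D})=1$. The Bloch space $\mathcal{B}$ consists of all $f\in H(\mathbb{D})$ with $\sup_{z\in\mathbb{D}}(1-|z|^2)|f'(z)|<\infty$, with norm $\|f\|_{\mathcal{B}}=|f(0)|+\sup_{z\in\mathbb{D}}(1-|z|^2)|f'(z)|$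 (equal to $\infty$ if $f\notin\mathcal{B}$). $\varphi^j$ denotes the $j$-th pointwise power of $\varphi$ (not an iterate), with $\varphi^0=1$; $j$ ranges over positive integers. *)

theory Defs
  imports "HOL-Complex_Analysis.Complex_Analysis"
begin

text \<open>
  A function on the unit disk \<open>ball 0 1\<close> is represented by a total function on \<^typ>\<open>complex\<close>
  whose values outside the disk are irrelevant: every notion below depends only on the
  values inside the disk.
\<close>

definition disk_area :: "complex measure" where
  "disk_area = uniform_measure lborel (ball 0 1)"

text \<open>The \<open>p\<close>-th power of the Bergman norm, with value \<open>\<infinity>\<close> when the integral diverges.\<close>

definition bergman_integral :: "real \<Rightarrow> real \<Rightarrow> (complex \<Rightarrow> complex) \<Rightarrow> ennreal" where
  "bergman_integral p \<alpha> f =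
     ennreal (\<alpha> + 1) *
       (\<integral>\<^sup>+z\<in>ball 0 1. ennreal (norm (f z) powr p * (1 - (norm z)\<^sup>2) powr \<alpha>) \<partial>disk_area)"

definition bergman_space :: "real \<Rightarrow> real \<Rightarrow> (complex \<Rightarrow> complex) set" where
  "bergman_space p \<alpha> = {f. f holomorphic_on ball 0 1 \<and> bergman_integral p \<alpha> f < \<infinity>}"

text \<open>Only meaningful on \<^const>\<open>bergman_space\<close>, since \<^const>\<open>enn2real\<close> sends \<open>\<infinity>\<close> to \<open>0\<close>.\<close>

definition bergman_norm :: "real \<Rightarrow> real \<Rightarrow> (complex \<Rightarrow> complex) \<Rightarrow> real" where
  "bergman_norm p \<alpha> f = enn2real (bergman_integral p \<alpha> f) powr (1 / p)"

definition bloch_seminorm :: "(complex \<Rightarrow> complex) \<Rightarrow> ennreal" where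
  "bloch_seminorm f = (SUP z\<in>ball 0 1. ennreal ((1 - (norm z)\<^sup>2) * norm (deriv f z)))"

definition bloch_space :: "(complex \<Rightarrow> complex) set" where
  "bloch_space = {f. f holomorphic_on ball 0 1 \<and> bloch_seminorm f < \<infinity>}"

definition bloch_norm :: "(complex \<Rightarrow> complex) \<Rightarrow> ennreal" where
  "bloch_norm f = ennreal (norm (f 0)) + bloch_seminorm f"

definition weighted_comp ::
  "(complex \<Rightarrow> complex) \<Rightarrow> (complex \<Rightarrow> complex) \<Rightarrow> (complex \<Rightarrow> complex) \<Rightarrow> complex \<Rightarrow> complex" where
  "weighted_comp u \<phi> f = (\<lambda>z. u z * f (\<phi> z))"

definition bounded_bergman_bloch ::
  "real \<Rightarrow> real \<Rightarrow> ((complex \<Rightarrow> complex) \<Rightarrow> complex \<Rightarrow> complex) \<Rightarrow> bool" where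
  "bounded_bergman_bloch p \<alpha> T \<longleftrightarrow>
     (\<forall>f\<in>bergman_space p \<alpha>. T f \<in> bloch_space) \<and>
     (\<exists>C\<ge>0. \<forall>f\<in>bergman_space p \<alpha>. bloch_norm (T f) \<le> ennreal (C * bergman_norm p \<alpha> f))"

definition I_op :: "(complex \<Rightarrow> complex) \<Rightarrow> (complex \<Rightarrow> complex) \<Rightarrow> complex \<Rightarrow> complex" where
  "I_op u g = (\<lambda>z. contour_integral (linepath 0 z) (\<lambda>\<xi>. deriv g \<xi> * u \<xi>))"

definition J_op :: "(complex \<Rightarrow> complex) \<Rightarrow> (complex \<Rightarrow> complex) \<Rightarrow> complex \<Rightarrow> complex" where
  "J_op u g = (\<lambda>z. contour_integral (linepath 0 z) (\<lambda>\<xi>. g \<xi> * deriv u \<xi>))"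

end

theory Submission
  imports Defs
begin

text \<open>
  Put \<open>\<gamma> = (2 + \<alpha>) / p\<close>. Since \<open>sup\<^sub>j j\<^sup>q r\<^sup>j\<^sup>-\<^sup>1\<close> is comparable to \<open>(1 - r\<^sup>2)\<^sup>-\<^sup>q\<close>, the
  two suprema are finite iff \<open>(1 - |z|\<^sup>2) |u \<phi>'|\<close> is \<open>O((1 - |\<phi>|\<^sup>2) powr (\<gamma> + 1))\<close> and
  \<open>(1 - |z|\<^sup>2) |u'|\<close> is \<open>O((1 - |\<phi>|\<^sup>2) powr \<gamma>)\<close>. These bounds suffice by the pointwise estimates
  for \<open>f\<close> and \<open>f'\<close> on the Bergman space, which come from the area mean value inequality for
  \<open>|f| powr p\<close>. For necessity, test the operator at \<open>z\<close> on the kernel function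
  \<open>k\<^sub>a(w) = (1 - |a|\<^sup>2) powr (1 / p) / (1 - cnj a w) powr ((3 + \<alpha>) / p)\<close> with \<open>a = \<phi> z\<close>, and on its
  product with the disk automorphism vanishing at \<open>a\<close>, which isolates the term \<open>u \<phi>'\<close>.
  The norm of \<open>k\<^sub>a\<close> is bounded because \<open>|1 - cnj a w|\<^sup>-\<^sup>2\<close> has circular mean
  \<open>1 / (1 - |a|\<^sup>2 |w|\<^sup>2)\<close> (the Poisson kernel), and the exponent \<open>3 + \<alpha>\<close> makes the remaining
  radial integral elementary.
\<close>

section \<open>Area integrals in the complex plane\<close>

text \<open>A Borel measure giving every box its volume is Lebesgue measure, and as
  \<open>Basis\<close> is \<open>{1, \<i>}\<close>, a complex box is a product of two real
  intervals. This makes Tonelli available in real and imaginary part.\<close>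

lemma lborel_complex_eq:
  "(lborel :: complex measure) = distr (lborel \<Otimes>\<^sub>M lborel) borel (\<lambda>(x, y). Complex x y)"
proof (rule lborel_eqI)
  have [measurable]: "(\<lambda>(x, y). Complex x y) \<in> borel_measurable (lborel \<Otimes>\<^sub>M lborel)"
    unfolding Complex_eq by measurable
  fix l u :: complex
  assume le: "\<And>b. b \<in> Basis \<Longrightarrow> l \<bullet> b \<le> u \<bullet> b"
  have le': "Re l \<le> Re u" "Im l \<le> Im u"
    using le[of 1] le[of \<i>] by (auto simp: Basis_complex_def inner_complex_def)
  have eq: "(\<lambda>(x, y). Complex x y) -` box l u = {Re l<..<Re u} \<times> {Im l<..<Im u}"
    by (auto simp: box_def Basis_complex_def inner_complex_def)
  have "emeasure (distr (lborel \<Otimes>\<^sub>M lborel) borel (\<lambda>(x, y). Complex x y)) (box l u)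
      = emeasure (lborel \<Otimes>\<^sub>M lborel) ({Re l<..<Re u} \<times> {Im l<..<Im u})"
    by (subst emeasure_distr) (auto simp: eq space_pair_measure)
  also have "\<dots> = ennreal (Re u - Re l) * ennreal (Im u - Im l)"
    using le' by (simp add: lborel.emeasure_pair_measure_Times)
  also have "\<dots> = (\<Prod>b\<in>Basis. (u - l) \<bullet> b)"
    using le' by (simp add: Basis_complex_def inner_complex_def ennreal_mult)
  finally show "emeasure (distr (lborel \<Otimes>\<^sub>M lborel) borel (\<lambda>(x, y). Complex x y)) (box l u)
      = (\<Prod>b\<in>Basis. (u - l) \<bullet> b)" .
qed simp

lemma nn_integral_complex_iterated:
  fixes f :: "complex \<Rightarrow> ennreal"
  assumes [measurable]: "f \<in> borel_measurable borel"
  shows "(\<integral>\<^sup>+z. f z \<partial>lborel) = (\<integral>\<^sup>+y. \<integral>\<^sup>+x. f (Complex x y) \<partial>lborel \<partial>lborel)"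
    and "(\<integral>\<^sup>+z. f z \<partial>lborel) = (\<integral>\<^sup>+x. \<integral>\<^sup>+y. f (Complex x y) \<partial>lborel \<partial>lborel)"
proof -
  have [measurable]: "(\<lambda>(x, y). Complex x y) \<in> borel_measurable (lborel \<Otimes>\<^sub>M lborel)"
    unfolding Complex_eq by measurable
  have m: "(\<lambda>(x, y). f (Complex x y)) \<in> borel_measurable (lborel \<Otimes>\<^sub>M lborel)"
    unfolding Complex_eq by measurable
  have eq: "(\<integral>\<^sup>+z. f z \<partial>lborel) = (\<integral>\<^sup>+w. (\<lambda>(x, y). f (Complex x y)) w \<partial>(lborel \<Otimes>\<^sub>M lborel))"
    by (subst lborel_complex_eq, subst nn_integral_distr) (auto simp: case_prod_beta intro!: nn_integral_cong)
  show "(\<integral>\<^sup>+z. f z \<partial>lborel) = (\<integral>\<^sup>+x. \<integral>\<^sup>+y. f (Complex x y) \<partial>lborel \<partial>lborel)"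
    unfolding eq using lborel.nn_integral_fst[OF m] by simp
  show "(\<integral>\<^sup>+z. f z \<partial>lborel) = (\<integral>\<^sup>+y. \<integral>\<^sup>+x. f (Complex x y) \<partial>lborel \<partial>lborel)"
    unfolding eq using lborel_pair.nn_integral_snd[OF m] by simp
qed

lemma nn_integral_complex_rotate:
  fixes f :: "complex \<Rightarrow> ennreal"
  assumes [measurable]: "f \<in> borel_measurable borel" and c: "norm c = 1"
  shows "(\<integral>\<^sup>+z. f (c * z) \<partial>lborel) = (\<integral>\<^sup>+z. f z \<partial>lborel)"
proof -
  \<comment> \<open>Substituting in one real coordinate at a time divides by \<open>Re c\<close>;
    if \<open>Re c = 0\<close>, then \<open>c\<close> is the square of a unit with nonzero real part.\<close>
  have *: "(\<integral>\<^sup>+z. f (c * z) \<partial>lborel) = (\<integral>\<^sup>+z. f z \<partial>lborel)"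
    if [measurable]: "f \<in> borel_measurable borel" and c: "norm c = 1" and "Re c \<noteq> 0"
    for f :: "complex \<Rightarrow> ennreal" and c :: complex
  proof -
    define a b where "a = Re c" and "b = Im c"
    have a: "a \<noteq> 0" and ab: "a * a + b * b = 1"
      using that c by (auto simp: a_def b_def cmod_def power2_eq_square)
    have [measurable]: "(\<lambda>z. f (c * z)) \<in> borel_measurable borel" by measurable
    have mC [measurable]: "(\<lambda>x. Complex (g x) (h x)) \<in> borel_measurable M"
      if "g \<in> borel_measurable M" "h \<in> borel_measurable M"
      for g h and M :: "'q measure"
      using that unfolding Complex_eq by measurable
    have "(\<integral>\<^sup>+z. f z \<partial>lborel) = (\<integral>\<^sup>+y. \<integral>\<^sup>+x. f (Complex x y) \<partial>lborel \<partial>lborel)"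
      by (rule nn_integral_complex_iterated) measurable
    also have "\<dots> = (\<integral>\<^sup>+y. ennreal \<bar>1/a\<bar> * (\<integral>\<^sup>+x. f (Complex (- b * y / a + 1/a * x) y) \<partial>lborel) \<partial>lborel)"
      by (intro nn_integral_cong nn_integral_real_affine) (use a in auto)
    also have "\<dots> = ennreal \<bar>1/a\<bar> * (\<integral>\<^sup>+y. (\<integral>\<^sup>+x. f (Complex (- b * y / a + 1/a * x) y) \<partial>lborel) \<partial>lborel)"
      by (rule nn_integral_cmult) measurable
    also have "(\<integral>\<^sup>+y. (\<integral>\<^sup>+x. f (Complex (- b * y / a + 1/a * x) y) \<partial>lborel) \<partial>lborel)
       = (\<integral>\<^sup>+x. (\<integral>\<^sup>+y. f (Complex (- b * y / a + 1/a * x) y) \<partial>lborel) \<partial>lborel)"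
      by (rule lborel_pair.Fubini') measurable
    \<comment> \<open>After Fubini, the second substitution \<open>y \<mapsto> b * x + a * y\<close>
      completes the first one to multiplication by \<open>c\<close>, as
      \<open>a * a + b * b = 1\<close>. The factors \<open>\<bar>1/a\<bar>\<close> and
      \<open>\<bar>a\<bar>\<close> of the two affine changes cancel.\<close>
    also have "\<dots> = (\<integral>\<^sup>+x. ennreal \<bar>a\<bar> * (\<integral>\<^sup>+y. f (Complex (- b * (b * x + a * y) / a + 1/a * x) (b * x + a * y)) \<partial>lborel) \<partial>lborel)"
      by (intro nn_integral_cong nn_integral_real_affine) (use a in auto)
    also have "\<dots> = ennreal \<bar>a\<bar> * (\<integral>\<^sup>+x. (\<integral>\<^sup>+y. f (Complex (- b * (b * x + a * y) / a + 1/a * x) (b * x + a * y)) \<partial>lborel) \<partial>lborel)"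
      by (rule nn_integral_cmult) measurable
    also have "(\<integral>\<^sup>+x. (\<integral>\<^sup>+y. f (Complex (- b * (b * x + a * y) / a + 1/a * x) (b * x + a * y)) \<partial>lborel) \<partial>lborel)
       = (\<integral>\<^sup>+x. (\<integral>\<^sup>+y. f (c * Complex x y) \<partial>lborel) \<partial>lborel)"
    proof (intro nn_integral_cong arg_cong[where f=f])
      fix x y :: real
      have "- b * (b * x + a * y) / a + 1/a * x = ((1 - b * b) * x) / a - b * y"
        using a by (simp add: field_simps)
      also have "1 - b * b = a * a" using ab by simp
      finally show "Complex (- b * (b * x + a * y) / a + 1/a * x) (b * x + a * y) = c * Complex x y"
        using a by (simp add: complex_eq_iff a_def b_def)
    qed
    also have "\<dots> = (\<integral>\<^sup>+z. f (c * z) \<partial>lborel)"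
      by (rule nn_integral_complex_iterated(2)[symmetric]) measurable
    finally show ?thesis using a
      by (simp add: mult.assoc[symmetric] ennreal_mult[symmetric] abs_mult[symmetric])
  qed
  show ?thesis
  proof (cases "Re c = 0")
    case True
    define d where "d = csqrt c"
    have dd: "d * d = c" unfolding d_def by (metis power2_csqrt power2_eq_square)
    have "norm d = 1"
      using c by (simp add: d_def norm_csqrt)
    moreover have "Re d \<noteq> 0"
    proof
      assume "Re d = 0"
      then have "Re (d * d) = - (norm d)\<^sup>2" by (simp add: cmod_def power2_eq_square)
      then show False using True \<open>norm d = 1\<close> dd by simp
    qed
    moreover have [measurable]: "(\<lambda>z. f (d * z)) \<in> borel_measurable borel" by measurable
    ultimately show ?thesis
      using *[of "\<lambda>z. f (d * z)" d] *[of f d] dd by (simp add: mult.assoc[symmetric])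
  qed (use * assms in blast)
qed

text \<open>The image of area on the disk under \<open>(norm z)\<^sup>2\<close> is \<open>pi\<close>
  times Lebesgue measure on \<open>{0..1}\<close>. It suffices to compare the two measures on rays
  \<open>{x<..}\<close>; for \<open>0 \<le> x < 1\<close> the preimage of a ray is an annulus of
  area \<open>pi * (1 - x)\<close>.\<close>

lemma nn_integral_radial_complex:
  fixes F :: "real \<Rightarrow> ennreal"
  assumes [measurable]: "F \<in> borel_measurable borel"
  shows "(\<integral>\<^sup>+z. F ((norm z)\<^sup>2) * indicator (ball (0::complex) 1) z \<partial>lborel)
    = ennreal pi * (\<integral>\<^sup>+t. F t * indicator {0..1} t \<partial>lborel)"
proof -
  let ?M = "distr (density lborel (indicator (ball (0::complex) 1))) borel (\<lambda>z. (norm z)\<^sup>2)"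
  let ?N = "density lborel (\<lambda>t::real. ennreal pi * indicator {0..1} t)"
  have M: "emeasure ?M {x<..} = emeasure lborel {z\<in>ball (0::complex) 1. x < (norm z)\<^sup>2}" for x
  proof -
    have "emeasure ?M {x<..} = emeasure (density lborel (indicator (ball (0::complex) 1))) ((\<lambda>z. (norm z)\<^sup>2) -` {x<..})"
      by (subst emeasure_distr) auto
    also have "\<dots> = (\<integral>\<^sup>+z. indicator {z\<in>ball (0::complex) 1. x < (norm z)\<^sup>2} z \<partial>lborel)"
    proof (subst emeasure_density)
      show "(indicator (ball (0::complex) 1) :: complex \<Rightarrow> ennreal) \<in> borel_measurable lborel"
        by (intro borel_measurable_indicator) simp
      have "(\<lambda>z::complex. (norm z)\<^sup>2) \<in> borel_measurable borel" by measurable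
      from measurable_sets[OF this, of "{x<..}"]
      show "(\<lambda>z::complex. (norm z)\<^sup>2) -` {x<..} \<in> sets lborel" by simp
    qed (rule nn_integral_cong, auto split: split_indicator)
    also have "\<dots> = emeasure lborel {z\<in>ball (0::complex) 1. x < (norm z)\<^sup>2}"
      by (rule nn_integral_indicator) measurable
    finally show ?thesis .
  qed
  have N: "emeasure ?N {x<..} = ennreal pi * emeasure lborel ({0..1} \<inter> {x<..})" for x
    by (auto simp: emeasure_density nn_integral_cmult mult.assoc indicator_inter_arith[symmetric])
  have ball: "emeasure lborel (ball (0::complex) 1) = ennreal pi"
    by (simp add: emeasure_ball unit_ball_vol_2)
  have "?M = ?N"
  proof (rule measure_eqI_lessThan)
    fix x
    have "emeasure ?M {x<..} \<le> emeasure lborel (ball (0::complex) 1)"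
      unfolding M by (intro emeasure_mono) auto
    then show "emeasure ?M {x<..} < \<infinity>"
      unfolding ball by (rule le_less_trans) simp
    show "emeasure ?M {x<..} = emeasure ?N {x<..}"
    proof (cases "x < 0")
      case True
      then have "{z\<in>ball (0::complex) 1. x < (norm z)\<^sup>2} = ball 0 1" "{0..1} \<inter> {x<..} = {0..1}"
        by (auto intro: less_le_trans)
      then show ?thesis unfolding M N by (simp add: ball)
    next
      case x0: False
      show ?thesis
      proof (cases "x < 1")
        case True
        have sq: "x < (norm z)\<^sup>2 \<longleftrightarrow> sqrt x < norm z" for z :: complex
          using real_sqrt_less_iff[of x "(norm z)\<^sup>2"] by simp
        have seteq: "{z\<in>ball (0::complex) 1. x < (norm z)\<^sup>2} = ball 0 1 - cball 0 (sqrt x)"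
          by (auto simp: not_le sq)
        have "emeasure ?M {x<..} = emeasure lborel (ball (0::complex) 1 - cball 0 (sqrt x))"
          unfolding M seteq ..
        also have "\<dots> = emeasure lborel (ball (0::complex) 1) - emeasure lborel (cball (0::complex) (sqrt x))"
        proof (rule emeasure_Diff)
          have "sqrt x < 1" using True by simp
          then show "cball (0::complex) (sqrt x) \<subseteq> ball 0 1" by (simp add: subset_eq del: real_sqrt_lt_1_iff)
        qed (use x0 in \<open>auto simp: emeasure_cball\<close>)
        also have "\<dots> = ennreal (pi - pi * x)"
          using x0 by (simp add: ball emeasure_cball unit_ball_vol_2 ennreal_minus)
        also have "{0..1} \<inter> {x<..} = {x<..1}" using x0 by auto
        then have "ennreal (pi - pi * x) = emeasure ?N {x<..}"
          unfolding N using True by (simp add: ennreal_mult[symmetric] algebra_simps)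
        finally show ?thesis .
      next
        case False
        have "(norm z)\<^sup>2 < 1" if "norm z < 1" for z :: complex
          using that by (simp add: power_less_one_iff)
        then have "\<not> x < (norm z)\<^sup>2" if "z \<in> ball 0 1" for z :: complex
          using that False by (meson less_trans mem_ball_0)
        then have e1: "{z\<in>ball (0::complex) 1. x < (norm z)\<^sup>2} = {}" by blast
        have e2: "{0..1} \<inter> {x<..} = {}" using False by auto
        show ?thesis unfolding M N e1 e2 by simp
      qed
    qed
  qed auto
  have "(\<integral>\<^sup>+z. F ((norm z)\<^sup>2) * indicator (ball (0::complex) 1) z \<partial>lborel) = (\<integral>\<^sup>+t. F t \<partial>?M)"
  proof -
    have ind: "(indicator (ball (0::complex) 1) :: complex \<Rightarrow> ennreal) \<in> borel_measurable lborel"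
      by (intro borel_measurable_indicator) simp
    have F: "(\<lambda>z::complex. F ((norm z)\<^sup>2)) \<in> borel_measurable lborel" by measurable
    have "(\<integral>\<^sup>+t. F t \<partial>?M) = (\<integral>\<^sup>+z. F ((norm z)\<^sup>2) \<partial>density lborel (indicator (ball (0::complex) 1)))"
      by (rule nn_integral_distr) measurable
    then show ?thesis
      by (simp add: nn_integral_density[OF ind F] mult.commute)
  qed
  also have "\<dots> = (\<integral>\<^sup>+t. F t \<partial>?N)" unfolding \<open>?M = ?N\<close> ..
  also have "\<dots> = ennreal pi * (\<integral>\<^sup>+t. F t * indicator {0..1} t \<partial>lborel)"
  proof (subst nn_integral_density)
    show "(\<integral>\<^sup>+t. ennreal pi * indicator {0..1} t * F t \<partial>lborel) = ennreal pi * (\<integral>\<^sup>+t. F t * indicator {0..1} t \<partial>lborel)"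
      by (subst nn_integral_cmult[symmetric]) (auto simp: mult_ac)
  qed auto
  finally show ?thesis .
qed

section \<open>Circle means and area means of holomorphic functions\<close>

text \<open>Cauchy's formula at the centre: the velocity of \<open>circlepath 0 1\<close> is
  \<open>2 * pi * \<i>\<close> times the point itself, which cancels the kernel
  \<open>1 / u\<close>.\<close>

lemma has_integral_unit_circle_mean:
  assumes "f holomorphic_on cball 0 1"
  shows "((\<lambda>t. f (cis (2 * pi * t))) has_integral f 0) {0..1}"
proof -
  have "((\<lambda>u. f u / (u - 0)) has_contour_integral 2 * of_real pi * \<i> * f 0) (circlepath 0 1)"
    using assms by (intro Cauchy_integral_circlepath_simple) auto
  then have "((\<lambda>t. 2 * of_real pi * \<i> * f (cis (2 * pi * t))) has_integral 2 * of_real pi * \<i> * f 0) {0..1}"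
    unfolding has_contour_integral
    by (rule has_integral_eq[rotated])
      (simp only: vector_derivative_circlepath, simp add: circlepath cis_conv_exp mult_ac)
  from has_integral_mult_right[OF this, of "inverse (2 * of_real pi * \<i>)"] show ?thesis
    by (simp add: field_simps)
qed

text \<open>The quotient \<open>(1 + q * x) / (1 - q * x)\<close> is holomorphic on the closed disk
  with value 1 at the centre, and its real part on the circle is \<open>1 - (norm q)\<^sup>2\<close>
  times the integrand.\<close>

lemma poisson_kernel_mean:
  assumes q: "norm q < 1"
  shows "((\<lambda>t. 1 / (norm (1 - q * cis (2 * pi * t)))\<^sup>2) has_integral 1 / (1 - (norm q)\<^sup>2)) {0..1}"
proof -
  have nz: "1 - q * x \<noteq> 0" if "norm x \<le> 1" for x
  proof
    assume "1 - q * x = 0"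
    then have "norm (q * x) = 1" by (metis eq_iff_diff_eq_0 norm_one)
    then show False using q that
      by (metis norm_mult mult_left_le norm_ge_zero not_less)
  qed
  have "(\<lambda>x. (1 + q * x) / (1 - q * x)) holomorphic_on cball 0 1"
    using nz by (intro holomorphic_intros) auto
  from has_integral_linear[OF has_integral_unit_circle_mean[OF this] bounded_linear_Re]
  have *: "((\<lambda>t. Re ((1 + q * cis (2 * pi * t)) / (1 - q * cis (2 * pi * t)))) has_integral 1) {0..1}"
    by (simp add: o_def)
  have Re: "Re ((1 + w) / (1 - w)) = (1 - (norm w)\<^sup>2) / (norm (1 - w))\<^sup>2" for w
    by (simp add: Re_divide cmod_power2) (simp add: algebra_simps power2_eq_square)
  have q1: "(norm q)\<^sup>2 < 1" using q by (simp add: power_less_one_iff)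
  show ?thesis
    using has_integral_mult_right[OF *, of "1 / (1 - (norm q)\<^sup>2)"] q1
    by (simp add: Re norm_mult)
qed

text \<open>Convexity in tangent-line form, ready to be integrated. With \<open>x = c * y\<close> it
  becomes \<open>p * y \<le> y powr p + (p - 1)\<close>, which is Young's inequality for
  \<open>y powr p\<close> and \<open>1\<close> with weights \<open>1/p\<close> and
  \<open>1 - 1/p\<close>.\<close>

lemma powr_above_tangent:
  fixes x c p :: real
  assumes "1 \<le> p" "0 \<le> x" "0 < c"
  shows "c powr p + p * c powr (p - 1) * (x - c) \<le> x powr p"
proof (cases "x = 0")
  case True
  have "c powr (p - 1) * c = c powr p"
    using assms by (simp add: powr_mult_base mult.commute)
  then show ?thesis using assms True by (simp add: mult.assoc)
next
  case False
  define y where "y = x / c"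
  have y: "0 < y" "x = c * y" using False assms by (auto simp: y_def)
  have "(y powr p) powr (1/p) * 1 powr (1 - 1/p) \<le> 1/p * (y powr p) + (1 - 1/p) * 1"
    using assms y by (intro Youngs_inequality_0) auto
  then have "p * y \<le> p * (1/p * (y powr p) + (1 - 1/p) * 1)"
    using assms y by (intro mult_left_mono) (simp_all add: powr_powr)
  also have "\<dots> = y powr p + (p - 1)"
    using assms by (simp add: field_simps)
  finally have "p * y \<le> y powr p + (p - 1)" .
  then have "c powr p * (1 + p * (y - 1)) \<le> c powr p * y powr p"
    by (intro mult_left_mono) (auto simp: algebra_simps)
  moreover have "c powr (p - 1) * c = c powr p"
    using assms by (simp add: powr_mult_base mult.commute)
  ultimately have "c powr p + p * (c powr (p - 1) * c) * (y - 1) \<le> (c * y) powr p"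
    using assms y by (simp add: powr_mult algebra_simps)
  then show ?thesis unfolding y(2) by (simp add: algebra_simps)
qed

text \<open>Each rotation preserves area and the disk, so integrating over the rotation parameter
  \<open>t\<close> in \<open>{0..1}\<close> changes nothing; Tonelli then moves the average inside
  the area integral.\<close>

lemma nn_integral_circle_average:
  fixes g :: "complex \<Rightarrow> ennreal"
  assumes [measurable]: "g \<in> borel_measurable borel"
  shows "(\<integral>\<^sup>+z. g z * indicator (ball 0 r) z \<partial>lborel)
    = (\<integral>\<^sup>+z. (\<integral>\<^sup>+t. g (cis (2 * pi * t) * z) * indicator {0..1} t \<partial>lborel) * indicator (ball 0 r) z \<partial>lborel)"
proof -
  let ?h = "\<lambda>z. g z * indicator (ball 0 r) z"
  have [measurable]: "ball (0::complex) r \<in> sets borel" by simp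
  have [measurable]: "?h \<in> borel_measurable borel" by measurable
  have [measurable]: "cis \<in> borel_measurable borel"
    by (intro borel_measurable_continuous_onI continuous_intros)
  have "(\<integral>\<^sup>+z. ?h z \<partial>lborel) = (\<integral>\<^sup>+t. (\<integral>\<^sup>+z. ?h z \<partial>lborel) * indicator {0..1} t \<partial>(lborel :: real measure))"
    by (subst nn_integral_cmult) auto
  also have "\<dots> = (\<integral>\<^sup>+t. (\<integral>\<^sup>+z. ?h (cis (2 * pi * t) * z) * indicator {0..1::real} t \<partial>lborel) \<partial>lborel)"
  proof (rule nn_integral_cong)
    fix t :: real
    have "(\<integral>\<^sup>+z. ?h z \<partial>lborel) = (\<integral>\<^sup>+z. ?h (cis (2 * pi * t) * z) \<partial>lborel)"
      by (rule nn_integral_complex_rotate[symmetric]) auto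
    then show "(\<integral>\<^sup>+z. ?h z \<partial>lborel) * indicator {0..1} t
      = (\<integral>\<^sup>+z. ?h (cis (2 * pi * t) * z) * indicator {0..1::real} t \<partial>lborel)"
      by (subst nn_integral_multc) (auto simp: norm_mult)
  qed
  also have "\<dots> = (\<integral>\<^sup>+z. (\<integral>\<^sup>+t. ?h (cis (2 * pi * t) * z) * indicator {0..1::real} t \<partial>lborel) \<partial>lborel)"
    by (rule lborel_pair.Fubini') measurable
  also have "\<dots> = (\<integral>\<^sup>+z. (\<integral>\<^sup>+t. g (cis (2 * pi * t) * z) * indicator {0..1} t \<partial>lborel) * indicator (ball 0 r) z \<partial>lborel)"
  proof (rule nn_integral_cong)
    fix z :: complex
    show "(\<integral>\<^sup>+t. ?h (cis (2 * pi * t) * z) * indicator {0..1::real} t \<partial>lborel)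
      = (\<integral>\<^sup>+t. g (cis (2 * pi * t) * z) * indicator {0..1} t \<partial>lborel) * indicator (ball 0 r) z"
      by (cases "norm z < r") (auto simp: norm_mult)
  qed
  finally show ?thesis .
qed

text \<open>Jensen's inequality through the tangent line of \<open>x powr p\<close> at
  \<open>c = norm (f 0)\<close>. Integrated over the circle, its linear term is nonnegative: the
  slope is nonnegative, and the mean of \<open>norm f\<close> is at least \<open>c\<close> by the
  mean value property.\<close>

lemma norm_powr_le_circle_mean:
  fixes f :: "complex \<Rightarrow> complex"
  assumes f: "f holomorphic_on cball 0 1" and p: "1 \<le> p"
  shows "ennreal (norm (f 0) powr p)
    \<le> (\<integral>\<^sup>+t. ennreal (norm (f (cis (2 * pi * t))) powr p) * indicator {0..1} t \<partial>lborel)"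
proof (cases "f 0 = 0")
  case False
  define c where "c = norm (f 0)"
  have c: "0 < c" using False by (simp add: c_def)
  let ?g = "\<lambda>t. norm (f (cis (2 * pi * t)))"
  have contf: "continuous_on {0..1} (\<lambda>t. f (cis (2 * pi * t)))"
    by (rule continuous_on_compose2[OF holomorphic_on_imp_continuous_on[OF f]])
      (auto intro!: continuous_intros)
  have gint: "?g integrable_on {0..1}"
    by (intro integrable_continuous_interval continuous_intros contf)
  have gpint: "(\<lambda>t. ?g t powr p) integrable_on {0..1}"
    by (intro integrable_continuous_interval continuous_on_powr' continuous_intros contf) (use p in auto)
  have mean: "((\<lambda>t. f (cis (2 * pi * t))) has_integral f 0) {0..1}"
    by (rule has_integral_unit_circle_mean[OF f])
  have "c \<le> integral {0..1} ?g"
    using integral_norm_bound_integral[of "\<lambda>t. f (cis (2 * pi * t))" "{0..1}" ?g] mean gint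
    by (auto simp: c_def has_integral_iff)
  then have "c powr p \<le> c powr p + p * c powr (p - 1) * (integral {0..1} ?g - c)"
    using p by simp
  also have "\<dots> = integral {0..1} (\<lambda>t. c powr p + p * c powr (p - 1) * (?g t - c))"
  proof -
    have "((\<lambda>t. c powr p + p * c powr (p - 1) * (?g t - c)) has_integral
        c powr p + p * c powr (p - 1) * (integral {0..1} ?g - c)) {0..1}"
      using has_integral_add[OF has_integral_const_real[of "c powr p" 0 1]
        has_integral_mult_right[OF has_integral_diff[OF integrable_integral[OF gint]
          has_integral_const_real[of c 0 1]], of "p * c powr (p - 1)"]] by simp
    then show ?thesis by (simp add: has_integral_iff)
  qed
  also have "\<dots> \<le> integral {0..1} (\<lambda>t. ?g t powr p)"
  proof (rule integral_le[OF _ gpint])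
    show "(\<lambda>t. c powr p + p * c powr (p - 1) * (?g t - c)) integrable_on {0..1}"
      by (intro integrable_continuous_interval continuous_intros contf)
  qed (use p c powr_above_tangent in auto)
  finally have "ennreal (c powr p) \<le> ennreal (integral {0..1} (\<lambda>t. ?g t powr p))"
    by (rule ennreal_leI)
  also have "\<dots> = (\<integral>\<^sup>+t. ennreal (?g t powr p) * indicator {0..1} t \<partial>lborel)"
    using nn_integral_has_integral_lebesgue[OF _ integrable_integral[OF gpint]]
    by (simp add: ennreal_mult' ennreal_indicator mult.commute)
  finally show ?thesis by (simp add: c_def)
qed (use p in simp)

text \<open>Functions are arbitrary outside the disk, so continuity on the ball yields measurability
  only after the cut-off by the indicator.\<close>

lemma borel_measurable_ennreal_mult_indicator_ball:
  fixes g :: "complex \<Rightarrow> real"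
  assumes "continuous_on (ball w r) g"
  shows "(\<lambda>z. ennreal (g z) * indicator (ball w r) z) \<in> borel_measurable borel"
proof -
  have "(\<lambda>z. indicator (ball w r) z *\<^sub>R g z) \<in> borel_measurable borel"
    using assms by (intro borel_measurable_continuous_on_indicator) simp_all
  then have "(\<lambda>z. ennreal (indicator (ball w r) z *\<^sub>R g z)) \<in> borel_measurable borel"
    by measurable
  also have "(\<lambda>z. ennreal (indicator (ball w r) z *\<^sub>R g z)) = (\<lambda>z. ennreal (g z) * indicator (ball w r) z)"
    by (auto simp: indicator_def)
  finally show ?thesis .
qed

text \<open>For each \<open>z\<close> in \<open>ball 0 r\<close> the circle inequality applies to
  \<open>\<lambda>x. f (w + x * z)\<close>. Integration over \<open>z\<close> gives the area of the
  disk on the left; on the right the rotation average is undone and a translation by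
  \<open>w\<close> restores the original disk.\<close>

lemma area_mean_powr:
  fixes f :: "complex \<Rightarrow> complex"
  assumes f: "f holomorphic_on ball w r" and p: "1 \<le> p" and r: "0 < r"
  shows "ennreal (norm (f w) powr p * (pi * r\<^sup>2))
    \<le> (\<integral>\<^sup>+z. ennreal (norm (f z) powr p) * indicator (ball w r) z \<partial>lborel)"
proof -
  have contf: "continuous_on (ball w r) f"
    using f by (rule holomorphic_on_imp_continuous_on)
  let ?g = "\<lambda>z. ennreal (norm (f z) powr p) * indicator (ball w r) z"
  have g: "?g \<in> borel_measurable borel"
    by (intro borel_measurable_ennreal_mult_indicator_ball continuous_on_powr' continuous_intros contf)
      (use p in auto)
  have gw: "(\<lambda>z. ?g (w + z)) \<in> borel_measurable borel"
    by (rule measurable_compose[OF _ g]) measurable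
  have "ennreal (norm (f w) powr p * (pi * r\<^sup>2))
      = (\<integral>\<^sup>+z. ennreal (norm (f w) powr p) * indicator (ball (0::complex) r) z \<partial>lborel)"
    using r by (subst nn_integral_cmult_indicator) (simp_all add: emeasure_ball unit_ball_vol_2 ennreal_mult)
  also have "\<dots> \<le> (\<integral>\<^sup>+z. (\<integral>\<^sup>+t. ?g (w + cis (2 * pi * t) * z) * indicator {0..1} t \<partial>lborel) * indicator (ball 0 r) z \<partial>lborel)"
  proof (rule nn_integral_mono, cases)
    fix z :: complex assume z: "z \<in> ball 0 r"
    have in_ball: "w + x * z \<in> ball w r" if "norm x \<le> 1" for x
    proof -
      have "norm (x * z) \<le> 1 * norm z"
        unfolding norm_mult using that by (intro mult_right_mono) auto
      then show ?thesis using z by (simp add: dist_norm)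
    qed
    have "(\<lambda>x. f (w + x * z)) holomorphic_on cball 0 1"
      by (rule holomorphic_on_compose_gen[OF _ f, unfolded o_def])
        (auto intro!: holomorphic_intros simp del: mem_ball simp: in_ball)
    from norm_powr_le_circle_mean[OF this p]
    have "ennreal (norm (f w) powr p)
      \<le> (\<integral>\<^sup>+t. ennreal (norm (f (w + cis (2 * pi * t) * z)) powr p) * indicator {0..1} t \<partial>lborel)"
      by simp
    also have "\<dots> = (\<integral>\<^sup>+t. ?g (w + cis (2 * pi * t) * z) * indicator {0..1} t \<partial>lborel)"
      by (intro nn_integral_cong) (simp del: mem_ball add: in_ball)
    finally show "ennreal (norm (f w) powr p) * indicator (ball 0 r) z
      \<le> (\<integral>\<^sup>+t. ?g (w + cis (2 * pi * t) * z) * indicator {0..1} t \<partial>lborel) * indicator (ball 0 r) z"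
      by (rule mult_right_mono) simp
  qed simp
  also have "\<dots> = (\<integral>\<^sup>+z. ?g (w + z) * indicator (ball 0 r) z \<partial>lborel)"
    by (rule nn_integral_circle_average[OF gw, symmetric])
  also have "\<dots> = (\<integral>\<^sup>+z. ?g (w + z) \<partial>lborel)"
    by (intro nn_integral_cong) (auto split: split_indicator simp: dist_norm)
  also have "\<dots> = (\<integral>\<^sup>+z. ?g z \<partial>distr lborel borel ((+) w))"
    by (rule nn_integral_distr[symmetric]) (use g in auto)
  also have "\<dots> = (\<integral>\<^sup>+z. ?g z \<partial>lborel)"
    by (simp only: lborel_distr_plus)
  finally show ?thesis .
qed

text \<open>Up to a constant, the antiderivative is the power \<open>\<alpha> + 1\<close> of
  \<open>(1 - t) / (1 - b * t)\<close>. This quotient has derivative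
  \<open>- (1 - b) / (1 - b * t)\<^sup>2\<close>, so the exponent \<open>2 + \<alpha>\<close> is
  exactly what the chain rule produces.\<close>

lemma beta_kernel_integral:
  fixes \<alpha> b :: real
  assumes \<alpha>: "-1 < \<alpha>" and b: "0 \<le> b" "b < 1"
  shows "(\<integral>\<^sup>+t. ennreal ((1 - t) powr \<alpha> * (1 - b * t) powr - (2 + \<alpha>)) * indicator {0..1} t \<partial>lborel)
    = ennreal (1 / ((\<alpha> + 1) * (1 - b)))"
proof -
  let ?F = "\<lambda>t. (1 - t) powr \<alpha> * (1 - b * t) powr - (2 + \<alpha>)"
  let ?G = "\<lambda>t. - (((1 - t) / (1 - b * t)) powr (\<alpha> + 1) / ((\<alpha> + 1) * (1 - b)))"
  have pos: "0 < 1 - b * t" if "t \<in> {0..1}" for t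
    using that b mult_left_le[of t b] by auto
  have "(?F has_integral ?G 1 - ?G 0) {0..1}"
  \<comment> \<open>Differentiability is asked only in the open interval: for
    \<open>\<alpha> < 0\<close> the integrand is unbounded near \<open>t = 1\<close>, whereas
    \<open>?G\<close> stays continuous because \<open>\<alpha> + 1 > 0\<close>.\<close>
  proof (rule fundamental_theorem_of_calculus_interior)
    show "continuous_on {0..1} ?G"
      using pos \<alpha> b by (auto intro!: continuous_intros continuous_on_powr' simp: less_imp_neq[symmetric])
        (fastforce dest: pos)+
    fix t :: real assume t: "t \<in> {0<..<1}"
    then have p: "0 < 1 - b * t" using pos by auto
    have q: "0 < (1 - t) / (1 - b * t)" using t p by simp
    have d: "((\<lambda>t. (1 - t) / (1 - b * t)) has_real_derivative - (1 - b) / (1 - b * t)\<^sup>2) (at t)"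
      using p by (auto intro!: derivative_eq_intros simp: power2_eq_square field_simps)
    have "(?G has_real_derivative - ((\<alpha> + 1) * ((1 - t) / (1 - b * t)) powr (\<alpha> + 1 - 1) *
        (- (1 - b) / (1 - b * t)\<^sup>2) / ((\<alpha> + 1) * (1 - b)))) (at t)"
      using DERIV_cdivide[OF DERIV_chain2[OF has_real_derivative_powr[OF q, of "\<alpha> + 1"] d], of "(\<alpha> + 1) * (1 - b)"]
      by (intro DERIV_minus) simp
    also have "- ((\<alpha> + 1) * ((1 - t) / (1 - b * t)) powr (\<alpha> + 1 - 1) *
        (- (1 - b) / (1 - b * t)\<^sup>2) / ((\<alpha> + 1) * (1 - b))) = ((1 - t) / (1 - b * t)) powr \<alpha> / (1 - b * t)\<^sup>2"
    proof -
      have "\<alpha> + 1 \<noteq> 0" "1 - b \<noteq> 0" using \<alpha> b by auto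
      then show ?thesis by (simp add: minus_divide_left[symmetric] divide_simps) (simp add: algebra_simps)
    qed
    also have "\<dots> = ?F t"
    proof -
      have "(1 - b * t) powr - (2 + \<alpha>) = 1 / ((1 - b * t)\<^sup>2 * (1 - b * t) powr \<alpha>)"
        unfolding powr_minus_divide powr_add using p by simp
      then show ?thesis using t p by (simp add: powr_divide)
    qed
    finally show "(?G has_vector_derivative ?F t) (at t)"
      by (simp add: has_real_derivative_iff_has_vector_derivative)
  qed simp
  then have "(?F has_integral 1 / ((\<alpha> + 1) * (1 - b))) {0..1}" using \<alpha> by simp
  from nn_integral_has_integral_lebesgue[OF _ this] show ?thesis
    by (simp add: ennreal_mult' ennreal_indicator mult.commute)
qed

section \<open>Pointwise estimates in the Bergman space\<close>

lemma bergman_integral_eq: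
  assumes f: "f holomorphic_on ball 0 1" and p: "1 \<le> p" and \<alpha>: "-1 < \<alpha>"
  shows "bergman_integral p \<alpha> f = ennreal ((\<alpha> + 1) / pi) *
    (\<integral>\<^sup>+z. ennreal (norm (f z) powr p * (1 - (norm z)\<^sup>2) powr \<alpha>) * indicator (ball 0 1) z \<partial>lborel)"
proof -
  let ?g = "\<lambda>z. norm (f z) powr p * (1 - (norm z)\<^sup>2) powr \<alpha>"
  let ?h = "\<lambda>z. ennreal (?g z) * indicator (ball 0 1) z"
  have contf: "continuous_on (ball 0 1) f"
    using f by (rule holomorphic_on_imp_continuous_on)
  have pos: "0 < 1 - (norm z)\<^sup>2" if "z \<in> ball 0 1" for z :: complex
    using that by (simp add: power_less_one_iff)
  have "continuous_on (ball 0 1) (\<lambda>z. norm (f z) powr p)"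
    by (intro continuous_on_powr' continuous_intros contf) (use p in auto)
  moreover have "continuous_on (ball 0 1) (\<lambda>z::complex. (1 - (norm z)\<^sup>2) powr \<alpha>)"
    by (intro continuous_intros) (use pos in fastforce)
  ultimately have "continuous_on (ball 0 1) ?g" by (rule continuous_on_mult)
  then have h: "?h \<in> borel_measurable lborel"
    using borel_measurable_ennreal_mult_indicator_ball by simp
  have "bergman_integral p \<alpha> f = ennreal (\<alpha> + 1) * ((\<integral>\<^sup>+z. ?h z * indicator (ball 0 1) z \<partial>lborel) / ennreal pi)"
    unfolding bergman_integral_def disk_area_def
    by (subst nn_integral_uniform_measure[OF h]) (simp_all add: emeasure_ball unit_ball_vol_2)
  also have "(\<integral>\<^sup>+z. ?h z * indicator (ball 0 1) z \<partial>lborel) = (\<integral>\<^sup>+z. ?h z \<partial>lborel)"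
    by (intro nn_integral_cong) (auto split: split_indicator)
  also have "ennreal (\<alpha> + 1) * ((\<integral>\<^sup>+z. ?h z \<partial>lborel) / ennreal pi) = ennreal ((\<alpha> + 1) / pi) * (\<integral>\<^sup>+z. ?h z \<partial>lborel)"
    using \<alpha> by (simp add: divide_ennreal[symmetric] divide_ennreal_def mult_ac)
  finally show ?thesis .
qed

text \<open>With \<open>r = (1 - norm w) / 2\<close>, moving by at most \<open>r\<close> keeps
  \<open>1 - norm z\<close> between \<open>r\<close> and \<open>3 * r\<close>, and
  \<open>1 + norm z\<close> lies between 1 and 2. Hence the Bergman weight is comparable to
  \<open>r powr \<alpha>\<close> on the disk of radius \<open>r\<close> about
  \<open>w\<close>.\<close>

lemma one_minus_norm_bounds:
  fixes w z :: complex
  assumes "norm w < 1" "dist w z \<le> (1 - norm w) / 2"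
  shows "(1 - norm w) / 2 \<le> 1 - (norm z)\<^sup>2" "1 - (norm z)\<^sup>2 \<le> 6 * ((1 - norm w) / 2)" "norm z < 1"
proof -
  have d: "\<bar>norm w - norm z\<bar> \<le> (1 - norm w) / 2"
    using norm_triangle_ineq3[of w z] assms by (simp add: dist_norm)
  have "norm z - norm w \<le> (1 - norm w) / 2" using d by linarith
  then show z: "norm z < 1" using assms(1) by (simp add: field_simps)
  have eq: "1 - (norm z)\<^sup>2 = (1 - norm z) * (1 + norm z)" by (simp add: power2_eq_square algebra_simps)
  have "(1 - norm w) / 2 \<le> (1 - norm z) * 1" "(1 - norm z) * 2 \<le> 6 * ((1 - norm w) / 2)"
    using d[unfolded abs_le_iff] by (auto simp: field_simps)
  moreover have "(1 - norm z) * 1 \<le> (1 - norm z) * (1 + norm z)"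
    by (rule mult_left_mono) (use z in auto)
  moreover have "(1 - norm z) * (1 + norm z) \<le> (1 - norm z) * 2"
    by (rule mult_left_mono) (use z in auto)
  ultimately show "(1 - norm w) / 2 \<le> 1 - (norm z)\<^sup>2" "1 - (norm z)\<^sup>2 \<le> 6 * ((1 - norm w) / 2)"
    unfolding eq by (meson order_trans)+
qed

lemma one_minus_norm_powr_neg_le:
  fixes w :: complex
  assumes "norm w < 1" "0 \<le> q"
  shows "((1 - norm w) / 2) powr - q \<le> 4 powr q * (1 - (norm w)\<^sup>2) powr - q"
proof -
  have "1 - (norm w)\<^sup>2 = (1 - norm w) * (1 + norm w)" by (simp add: power2_eq_square algebra_simps)
  moreover have "(1 - norm w) * (1 + norm w) \<le> (1 - norm w) * 2"
    using assms by (intro mult_left_mono) auto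
  moreover have pos: "0 < 1 - (norm w)\<^sup>2" using assms by (simp add: power_less_one_iff)
  ultimately have "((1 - norm w) / 2) powr - q \<le> ((1 - (norm w)\<^sup>2) / 4) powr - q"
    using assms by (intro powr_mono2') auto
  also have "\<dots> = 4 powr q * (1 - (norm w)\<^sup>2) powr - q"
    using pos by (simp add: powr_divide powr_minus field_simps)
  finally show ?thesis .
qed

text \<open>The area mean value inequality is applied on the disk of radius
  \<open>r = (1 - norm w) / 2\<close> about \<open>w\<close>. Area contributes
  \<open>r\<^sup>2\<close> and the weight \<open>r powr \<alpha>\<close>; the \<open>p\<close>-th
  root turns \<open>2 + \<alpha>\<close> into the stated exponent.\<close>

lemma bergman_point_evaluation:
  fixes p \<alpha> :: real
  assumes p: "1 \<le> p" and \<alpha>: "-1 < \<alpha>"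
  obtains C where "0 \<le> C" "\<And>f w. f \<in> bergman_space p \<alpha> \<Longrightarrow> norm w < 1 \<Longrightarrow>
    norm (f w) \<le> C * bergman_norm p \<alpha> f * ((1 - norm w) / 2) powr - ((2 + \<alpha>) / p)"
proof
  \<comment> \<open>On the small disk \<open>1 - (norm z)\<^sup>2\<close> lies between
    \<open>r\<close> and \<open>6 * r\<close>, so its power \<open>\<alpha>\<close> is at least
    \<open>r powr \<alpha>\<close> if \<open>\<alpha> \<ge> 0\<close> and at least
    \<open>(6 * r) powr \<alpha>\<close> otherwise; \<open>c\<close> covers both signs.\<close>
  define c where "c = min 1 (6 powr \<alpha>)"
  have c: "0 < c" by (simp add: c_def)
  let ?K = "1 / ((\<alpha> + 1) * c)"
  show "0 \<le> ?K powr (1 / p)" by simp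
  fix f and w :: complex assume f: "f \<in> bergman_space p \<alpha>" and w: "norm w < 1"
  define r where "r = (1 - norm w) / 2"
  have r: "0 < r" using w by (simp add: r_def)
  define N where "N = enn2real (bergman_integral p \<alpha> f)"
  have hol: "f holomorphic_on ball 0 1" and fin: "bergman_integral p \<alpha> f < \<infinity>"
    using f by (auto simp: bergman_space_def)
  \<comment> \<open>\<open>enn2real\<close> loses nothing here, since membership in the Bergman
    space makes the integral finite.\<close>
  have N: "bergman_integral p \<alpha> f = ennreal N" "0 \<le> N"
    using fin by (auto simp: N_def)
  have sub: "ball w r \<subseteq> ball 0 1"
    using one_minus_norm_bounds(3)[OF w] by (auto simp: r_def)
  have weight: "c * r powr \<alpha> \<le> (1 - (norm z)\<^sup>2) powr \<alpha>" if "z \<in> ball w r" for z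
  proof -
    have z: "r \<le> 1 - (norm z)\<^sup>2" "1 - (norm z)\<^sup>2 \<le> 6 * r"
      using one_minus_norm_bounds[OF w, of z] that by (auto simp: r_def)
    show ?thesis
    proof (cases "0 \<le> \<alpha>")
      case True
      have "c * r powr \<alpha> \<le> 1 * r powr \<alpha>" by (intro mult_right_mono) (auto simp: c_def)
      also have "\<dots> \<le> (1 - (norm z)\<^sup>2) powr \<alpha>" using True z r by (auto intro!: powr_mono2)
      finally show ?thesis .
    next
      case False
      have "c * r powr \<alpha> \<le> 6 powr \<alpha> * r powr \<alpha>" by (intro mult_right_mono) (auto simp: c_def)
      also have "\<dots> = (6 * r) powr \<alpha>" using r by (simp add: powr_mult)
      also have "\<dots> \<le> (1 - (norm z)\<^sup>2) powr \<alpha>" using False z r by (intro powr_mono2') auto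
      finally show ?thesis .
    qed
  qed
  let ?g = "\<lambda>z. ennreal (norm (f z) powr p) * indicator (ball w r) z"
  have "ennreal (c * r powr \<alpha>) * ennreal (norm (f w) powr p * (pi * r\<^sup>2))
      \<le> ennreal (c * r powr \<alpha>) * (\<integral>\<^sup>+z. ?g z \<partial>lborel)"
    by (intro mult_left_mono area_mean_powr holomorphic_on_subset[OF hol sub] p r) simp
  also have "\<dots> = (\<integral>\<^sup>+z. ennreal (c * r powr \<alpha>) * ?g z \<partial>lborel)"
  proof (rule nn_integral_cmult[symmetric])
    have "continuous_on (ball w r) f"
      using hol sub by (meson holomorphic_on_imp_continuous_on continuous_on_subset)
    then have "continuous_on (ball w r) (\<lambda>z. norm (f z) powr p)"
      by (intro continuous_on_powr' continuous_intros) (use p in auto)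
    then show "?g \<in> borel_measurable lborel"
      using borel_measurable_ennreal_mult_indicator_ball by simp
  qed
  also have "\<dots> \<le> (\<integral>\<^sup>+z. ennreal (norm (f z) powr p * (1 - (norm z)\<^sup>2) powr \<alpha>) * indicator (ball 0 1) z \<partial>lborel)"
  proof (rule nn_integral_mono, cases)
    fix z assume z: "z \<in> ball w r"
    then have "z \<in> ball 0 1" using sub by blast
    moreover have "ennreal (c * r powr \<alpha>) * ennreal (norm (f z) powr p)
        \<le> ennreal (norm (f z) powr p * (1 - (norm z)\<^sup>2) powr \<alpha>)"
      using weight[OF z] c by (subst ennreal_mult[symmetric])
        (auto simp: mult.commute[of _ "norm (f z) powr p"] intro!: ennreal_leI mult_left_mono)
    ultimately show "ennreal (c * r powr \<alpha>) * ?g z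
        \<le> ennreal (norm (f z) powr p * (1 - (norm z)\<^sup>2) powr \<alpha>) * indicator (ball 0 1) z"
      using z by simp
  qed simp
  finally have "ennreal ((\<alpha> + 1) / pi) * (ennreal (c * r powr \<alpha>) * ennreal (norm (f w) powr p * (pi * r\<^sup>2)))
     \<le> bergman_integral p \<alpha> f"
    unfolding bergman_integral_eq[OF hol p \<alpha>] by (rule mult_left_mono) simp
  then have "(\<alpha> + 1) / pi * (c * r powr \<alpha> * (norm (f w) powr p * (pi * r\<^sup>2))) \<le> N"
    using \<alpha> c N by (simp add: ennreal_mult[symmetric])
  moreover have "(\<alpha> + 1) / pi * (c * r powr \<alpha> * (norm (f w) powr p * (pi * r\<^sup>2)))
      = norm (f w) powr p * ((\<alpha> + 1) * c * r powr (2 + \<alpha>))"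
    using r by (simp add: powr_add)
  ultimately have "norm (f w) powr p * ((\<alpha> + 1) * c * r powr (2 + \<alpha>)) \<le> N" by (simp only:)
  moreover have "0 < (\<alpha> + 1) * c * r powr (2 + \<alpha>)" using \<alpha> c r by simp
  ultimately have "norm (f w) powr p \<le> N / ((\<alpha> + 1) * c * r powr (2 + \<alpha>))"
    by (simp add: pos_le_divide_eq)
  also have "\<dots> = ?K * N * r powr - (2 + \<alpha>)"
    unfolding powr_minus_divide by simp
  finally have "(norm (f w) powr p) powr (1 / p) \<le> (?K * N * r powr - (2 + \<alpha>)) powr (1 / p)"
    using p by (intro powr_mono2) auto
  also have "(norm (f w) powr p) powr (1 / p) = norm (f w)"
    using p by (simp add: powr_powr)
  also have "(?K * N * r powr - (2 + \<alpha>)) powr (1 / p) = ?K powr (1 / p) * N powr (1 / p) * r powr - ((2 + \<alpha>) / p)"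
    unfolding powr_mult powr_powr by (simp add: minus_divide_left)
  finally show "norm (f w) \<le> ?K powr (1 / p) * bergman_norm p \<alpha> f * ((1 - norm w) / 2) powr - ((2 + \<alpha>) / p)"
    unfolding bergman_norm_def N_def r_def .
qed

text \<open>The bound for \<open>deriv f\<close> is Cauchy's estimate on the circle of radius
  \<open>(1 - norm w) / 2\<close> about \<open>w\<close>; dividing by the radius raises the exponent
  by one.\<close>

lemma bergman_pointwise_bounds:
  fixes p \<alpha> :: real
  assumes p: "1 \<le> p" and \<alpha>: "-1 < \<alpha>"
  obtains C where "0 \<le> C"
    "\<And>f w. f \<in> bergman_space p \<alpha> \<Longrightarrow> norm w < 1 \<Longrightarrow>
      norm (f w) \<le> C * bergman_norm p \<alpha> f * (1 - (norm w)\<^sup>2) powr - ((2 + \<alpha>) / p)"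
    "\<And>f w. f \<in> bergman_space p \<alpha> \<Longrightarrow> norm w < 1 \<Longrightarrow>
      norm (deriv f w) \<le> C * bergman_norm p \<alpha> f * (1 - (norm w)\<^sup>2) powr - ((2 + \<alpha>) / p + 1)"
proof -
  define \<gamma> where "\<gamma> = (2 + \<alpha>) / p"
  have \<gamma>: "0 < \<gamma>" using p \<alpha> by (simp add: \<gamma>_def)
  obtain C where C: "0 \<le> C" "\<And>f w. f \<in> bergman_space p \<alpha> \<Longrightarrow> norm w < 1 \<Longrightarrow>
    norm (f w) \<le> C * bergman_norm p \<alpha> f * ((1 - norm w) / 2) powr - \<gamma>"
    using bergman_point_evaluation[OF p \<alpha>] unfolding \<gamma>_def by blast
  have N: "0 \<le> bergman_norm p \<alpha> f" for f by (simp add: bergman_norm_def)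
  have le: "C * bergman_norm p \<alpha> f * ((1 - norm w) / 2) powr - q
    \<le> C * 4 powr q * bergman_norm p \<alpha> f * (1 - (norm w)\<^sup>2) powr - q"
    if "norm w < 1" "0 \<le> q" for f q and w :: complex
    using mult_left_mono[OF one_minus_norm_powr_neg_le[OF that], of "C * bergman_norm p \<alpha> f"] C N
    by (simp add: mult_ac)
  show ?thesis
  \<comment> \<open>One constant serves both bounds. The derivative costs
    \<open>2 powr \<gamma>\<close> for halving the radius and \<open>4 powr (\<gamma> + 1)\<close>
    for passing to \<open>1 - (norm w)\<^sup>2\<close>; this dominates the
    \<open>4 powr \<gamma>\<close> needed for \<open>f\<close>.\<close>
  proof (rule that[of "C * (2 powr \<gamma> * 4 powr (\<gamma> + 1))"], unfold \<gamma>_def[symmetric])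
    fix f and w :: complex assume f: "f \<in> bergman_space p \<alpha>" and w: "norm w < 1"
    show "norm (f w) \<le> C * (2 powr \<gamma> * 4 powr (\<gamma> + 1)) * bergman_norm p \<alpha> f * (1 - (norm w)\<^sup>2) powr - \<gamma>"
    proof -
      have "norm (f w) \<le> C * 4 powr \<gamma> * bergman_norm p \<alpha> f * (1 - (norm w)\<^sup>2) powr - \<gamma>"
        using C(2)[OF f w] le[OF w, of \<gamma> f] \<gamma> by simp
      also have "\<dots> \<le> C * (2 powr \<gamma> * 4 powr (\<gamma> + 1)) * bergman_norm p \<alpha> f * (1 - (norm w)\<^sup>2) powr - \<gamma>"
      proof (intro mult_right_mono mult_left_mono)
        have "1 * (4::real) powr \<gamma> \<le> 2 powr \<gamma> * 4 powr (\<gamma> + 1)"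
          using \<gamma> by (intro mult_mono powr_mono ge_one_powr_ge_zero) auto
        then show "4 powr \<gamma> \<le> 2 powr \<gamma> * (4::real) powr (\<gamma> + 1)" by simp
      qed (use C N in auto)
      finally show ?thesis .
    qed
    let ?r = "(1 - norm w) / 2"
    have r: "0 < ?r" using w by simp
    have hol: "f holomorphic_on ball 0 1" using f by (simp add: bergman_space_def)
    have sub: "cball w ?r \<subseteq> ball 0 1"
      using one_minus_norm_bounds(3)[OF w] by auto
    have "norm ((deriv ^^ 1) f w) \<le> fact 1 * (C * bergman_norm p \<alpha> f * (?r / 2) powr - \<gamma>) / ?r ^ 1"
    proof (rule Cauchy_inequality)
      show "f holomorphic_on ball w ?r"
        using holomorphic_on_subset[OF hol] sub ball_subset_cball by blast
      show "continuous_on (cball w ?r) f"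
        using holomorphic_on_imp_continuous_on[OF hol] sub continuous_on_subset by blast
      fix z assume z: "norm (w - z) = ?r"
      then have z1: "norm z < 1" using one_minus_norm_bounds(3)[OF w, of z] by (simp add: dist_norm)
      \<comment> \<open>As \<open>norm w = 1 - 2 * ?r\<close>, points of the circle satisfy
        \<open>1 - norm z \<ge> ?r\<close>, which makes the point evaluation bound uniform on
        it.\<close>
      have "norm z \<le> norm w + ?r" using z norm_triangle_ineq3[of w z] by linarith
      then have "?r / 2 \<le> (1 - norm z) / 2" by (simp add: field_simps)
      then have "((1 - norm z) / 2) powr - \<gamma> \<le> (?r / 2) powr - \<gamma>"
        using r \<gamma> by (intro powr_mono2') auto
      then show "norm (f z) \<le> C * bergman_norm p \<alpha> f * (?r / 2) powr - \<gamma>"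
        using C(2)[OF f z1] mult_left_mono[of _ _ "C * bergman_norm p \<alpha> f"] C(1) N[of f]
        by (meson mult_nonneg_nonneg order_trans)
    qed (rule r)
    from this have "norm (deriv f w) \<le> C * 2 powr \<gamma> * bergman_norm p \<alpha> f * ?r powr - (\<gamma> + 1)"
    proof -
      have "(?r / 2) powr - \<gamma> / ?r = 2 powr \<gamma> * ?r powr - (\<gamma> + 1)"
        unfolding powr_minus_divide powr_divide powr_add using r by simp
      moreover assume "norm ((deriv ^^ 1) f w) \<le> fact 1 * (C * bergman_norm p \<alpha> f * (?r / 2) powr - \<gamma>) / ?r ^ 1"
      then have "norm (deriv f w) \<le> C * bergman_norm p \<alpha> f * ((?r / 2) powr - \<gamma> / ?r)" by simp
      ultimately show ?thesis by (simp add: mult_ac)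
    qed
    also have "\<dots> \<le> C * 2 powr \<gamma> * bergman_norm p \<alpha> f * (4 powr (\<gamma> + 1) * (1 - (norm w)\<^sup>2) powr - (\<gamma> + 1))"
      using C N \<gamma> w by (intro mult_left_mono one_minus_norm_powr_neg_le) auto
    finally show "norm (deriv f w) \<le> C * (2 powr \<gamma> * 4 powr (\<gamma> + 1)) * bergman_norm p \<alpha> f * (1 - (norm w)\<^sup>2) powr - (\<gamma> + 1)"
      by (simp add: mult_ac)
  qed (use C in auto)
qed

section \<open>Kernel functions\<close>

text \<open>With \<open>?s = norm a * norm z < 1\<close>, these rest on
  \<open>1 - ?s\<^sup>2 = (1 - ?s) * (1 + ?s)\<close> and
  \<open>1 - ?s \<le> norm (1 - cnj a * z)\<close>. The positive real part keeps
  \<open>1 - cnj a * z\<close> off the branch cut of \<open>Ln\<close>.\<close>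

lemma one_minus_cnj_mult_bounds:
  fixes a z :: complex
  assumes a: "norm a < 1" and z: "norm z \<le> 1"
  shows "0 < 1 - (norm a)\<^sup>2 * (norm z)\<^sup>2" "1 - (norm a)\<^sup>2 * (norm z)\<^sup>2 \<le> 2 * norm (1 - cnj a * z)"
    "0 < Re (1 - cnj a * z)"
proof -
  let ?s = "norm a * norm z"
  have s: "?s < 1" "0 \<le> ?s" using a z mult_right_mono[of "norm z" 1 "norm a"]
    by (auto simp: mult.commute)
  have "1 - ?s \<le> norm (1 - cnj a * z)"
    using norm_triangle_ineq2[of 1 "cnj a * z"] by (simp add: norm_mult)
  moreover have "1 - ?s\<^sup>2 = (1 - ?s) * (1 + ?s)" by (simp add: power2_eq_square algebra_simps)
  moreover have "(1 - ?s) * (1 + ?s) \<le> (1 - ?s) * 2" using s by (intro mult_left_mono) auto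
  ultimately show "1 - (norm a)\<^sup>2 * (norm z)\<^sup>2 \<le> 2 * norm (1 - cnj a * z)"
    by (simp add: power_mult_distrib)
  show "0 < 1 - (norm a)\<^sup>2 * (norm z)\<^sup>2"
    using s by (simp add: power_less_one_iff flip: power_mult_distrib)
  have "Re (cnj a * z) \<le> norm (cnj a * z)" by (rule complex_Re_le_cmod)
  then show "0 < Re (1 - cnj a * z)" using s by (simp add: norm_mult)
qed

text \<open>The exponent is split as \<open>3 + \<alpha> = 2 + (1 + \<alpha>)\<close>. The second
  power has a radial bound; the first is averaged over circles by the Poisson kernel, raising the
  radial exponent to \<open>2 + \<alpha>\<close>. The remaining integral yields
  \<open>1 / (1 - b)\<close>, which cancels the factor \<open>1 - (norm a)\<^sup>2\<close>.\<close>

lemma bergman_integral_kernel_bound: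
  fixes a :: complex
  assumes f: "f holomorphic_on ball 0 1" and p: "1 \<le> p" and \<alpha>: "-1 < \<alpha>" and a: "norm a < 1"
    and le: "\<And>z. norm z < 1 \<Longrightarrow>
      norm (f z) powr p \<le> (1 - (norm a)\<^sup>2) * norm (1 - cnj a * z) powr - (3 + \<alpha>)"
  shows "bergman_integral p \<alpha> f \<le> ennreal (2 powr (1 + \<alpha>))"
proof -
  define b where "b = (norm a)\<^sup>2"
  have b: "0 \<le> b" "b < 1" using a by (auto simp: b_def power_less_one_iff)
  \<comment> \<open>\<open>R q t\<close> collects the radial factors at
    \<open>t = (norm z)\<^sup>2\<close>; \<open>q\<close> is \<open>1 + \<alpha>\<close> before the
    circle average and \<open>2 + \<alpha>\<close> after it.\<close>
  define R where "R q t = ennreal ((1 - b) * 2 powr (1 + \<alpha>) * ((1 - t) powr \<alpha> * (1 - b * t) powr - q))" for q t :: real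
  have [measurable]: "R q \<in> borel_measurable borel" for q
    unfolding R_def by measurable
  let ?h = "\<lambda>z. ennreal (1 / (norm (1 - cnj a * z))\<^sup>2) * R (1 + \<alpha>) ((norm z)\<^sup>2)"
  have h: "?h \<in> borel_measurable borel" by measurable
  have "(\<integral>\<^sup>+z. ennreal (norm (f z) powr p * (1 - (norm z)\<^sup>2) powr \<alpha>) * indicator (ball 0 1) z \<partial>lborel)
    \<le> (\<integral>\<^sup>+z. ?h z * indicator (ball 0 1) z \<partial>lborel)"
  proof (rule nn_integral_mono, cases)
    fix z :: complex assume "z \<in> ball 0 1"
    then have z: "norm z < 1" by simp
    let ?n = "norm (1 - cnj a * z)" and ?d = "1 - b * (norm z)\<^sup>2"
    have d: "0 < ?d" "?d / 2 \<le> ?n" "0 < ?n"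
      using one_minus_cnj_mult_bounds[OF a, of z] z by (auto simp: b_def)
    have "?n powr - (3 + \<alpha>) = ?n powr - 2 * ?n powr - (1 + \<alpha>)"
      by (simp flip: powr_add)
    also have "\<dots> \<le> ?n powr - 2 * (?d / 2) powr - (1 + \<alpha>)"
      using d \<alpha> by (intro mult_left_mono powr_mono2') auto
    also have "?n powr - 2 = 1 / ?n\<^sup>2"
      using d by (simp add: powr_minus_divide)
    also have "(?d / 2) powr - (1 + \<alpha>) = 2 powr (1 + \<alpha>) * ?d powr - (1 + \<alpha>)"
      unfolding powr_divide powr_minus_divide by simp
    finally have "(1 - b) * ?n powr - (3 + \<alpha>) \<le> (1 - b) * (1 / ?n\<^sup>2 * (2 powr (1 + \<alpha>) * ?d powr - (1 + \<alpha>)))"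
      using b by (intro mult_left_mono) auto
    then have "norm (f z) powr p \<le> (1 - b) * (1 / ?n\<^sup>2 * (2 powr (1 + \<alpha>) * ?d powr - (1 + \<alpha>)))"
      using le[OF z, folded b_def] by (rule order_trans[rotated])
    then have "norm (f z) powr p * (1 - (norm z)\<^sup>2) powr \<alpha>
      \<le> (1 - b) * (1 / ?n\<^sup>2 * (2 powr (1 + \<alpha>) * ?d powr - (1 + \<alpha>))) * (1 - (norm z)\<^sup>2) powr \<alpha>"
      by (rule mult_right_mono) simp
    then have "ennreal (norm (f z) powr p * (1 - (norm z)\<^sup>2) powr \<alpha>) \<le> ?h z"
      unfolding R_def using b by (subst ennreal_mult[symmetric]) (auto intro!: ennreal_leI simp: mult_ac)
    then show "ennreal (norm (f z) powr p * (1 - (norm z)\<^sup>2) powr \<alpha>) * indicator (ball 0 1) z \<le> ?h z * indicator (ball 0 1) z"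
      by (rule mult_right_mono) simp
  qed simp
  also have "\<dots> = (\<integral>\<^sup>+z. (\<integral>\<^sup>+t. ?h (cis (2 * pi * t) * z) * indicator {0..1} t \<partial>lborel) * indicator (ball 0 1) z \<partial>lborel)"
    by (rule nn_integral_circle_average[OF h])
  also have "\<dots> = (\<integral>\<^sup>+z. R (2 + \<alpha>) ((norm z)\<^sup>2) * indicator (ball (0::complex) 1) z \<partial>lborel)"
  proof (rule nn_integral_cong, cases)
    fix z :: complex assume "z \<in> ball 0 1"
    then have z: "norm z < 1" by simp
    let ?q = "cnj a * z"
    have q: "norm ?q < 1"
      using a z mult_strict_mono'[of "norm a" 1 "norm z" 1] by (simp add: norm_mult)
    have d: "0 < 1 - b * (norm z)\<^sup>2"
      using one_minus_cnj_mult_bounds[OF a, of z] z by (auto simp: b_def)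
    have [measurable]: "cis \<in> borel_measurable borel"
      by (intro borel_measurable_continuous_onI continuous_intros)
    have "(\<integral>\<^sup>+t. ?h (cis (2 * pi * t) * z) * indicator {0..1} t \<partial>lborel)
      = (\<integral>\<^sup>+t. R (1 + \<alpha>) ((norm z)\<^sup>2) * ennreal (indicator {0..1} t * (1 / (norm (1 - ?q * cis (2 * pi * t)))\<^sup>2)) \<partial>lborel)"
      by (intro nn_integral_cong) (auto simp: norm_mult mult_ac split: split_indicator)
    also have "\<dots> = R (1 + \<alpha>) ((norm z)\<^sup>2) * (\<integral>\<^sup>+t. ennreal (indicator {0..1} t * (1 / (norm (1 - ?q * cis (2 * pi * t)))\<^sup>2)) \<partial>lborel)"
      by (rule nn_integral_cmult) measurable
    also have "(\<integral>\<^sup>+t. ennreal (indicator {0..1} t * (1 / (norm (1 - ?q * cis (2 * pi * t)))\<^sup>2)) \<partial>lborel) = ennreal (1 / (1 - (norm ?q)\<^sup>2))"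
      by (rule nn_integral_has_integral_lebesgue[OF _ poisson_kernel_mean[OF q]]) simp
    also have "R (1 + \<alpha>) ((norm z)\<^sup>2) * \<dots> = R (2 + \<alpha>) ((norm z)\<^sup>2)"
    proof -
      have "(1 - b * (norm z)\<^sup>2) powr (2 + \<alpha>) = (1 - b * (norm z)\<^sup>2) powr (1 + \<alpha>) * (1 - b * (norm z)\<^sup>2)"
        using d powr_add[of "1 - b * (norm z)\<^sup>2" "1 + \<alpha>" 1] by (simp add: add.commute)
      then have "(1 - b * (norm z)\<^sup>2) powr - (2 + \<alpha>) = (1 - b * (norm z)\<^sup>2) powr - (1 + \<alpha>) * (1 / (1 - b * (norm z)\<^sup>2))"
        unfolding powr_minus_divide by simp
      then show ?thesis
        unfolding R_def using b d
        by (subst ennreal_mult[symmetric]) (simp_all add: norm_mult power_mult_distrib b_def[symmetric] mult_ac)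
    qed
    finally show "(\<integral>\<^sup>+t. ?h (cis (2 * pi * t) * z) * indicator {0..1} t \<partial>lborel) * indicator (ball 0 1) z
      = R (2 + \<alpha>) ((norm z)\<^sup>2) * indicator (ball 0 1) z" by simp
  qed simp
  also have "\<dots> = ennreal pi * (\<integral>\<^sup>+t. R (2 + \<alpha>) t * indicator {0..1} t \<partial>lborel)"
    by (rule nn_integral_radial_complex) measurable
  also have "(\<integral>\<^sup>+t. R (2 + \<alpha>) t * indicator {0..1} t \<partial>lborel)
    = ennreal ((1 - b) * 2 powr (1 + \<alpha>)) * (\<integral>\<^sup>+t. ennreal ((1 - t) powr \<alpha> * (1 - b * t) powr - (2 + \<alpha>)) * indicator {0..1} t \<partial>lborel)"
    unfolding R_def using b
    by (subst nn_integral_cmult[symmetric]) (auto simp: ennreal_mult mult.assoc)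
  also have "\<dots> = ennreal ((1 - b) * 2 powr (1 + \<alpha>)) * ennreal (1 / ((\<alpha> + 1) * (1 - b)))"
    by (simp only: beta_kernel_integral[OF \<alpha> b])
  also have "\<dots> = ennreal (2 powr (1 + \<alpha>) / (\<alpha> + 1))"
    using b \<alpha> by (subst ennreal_mult[symmetric]) auto
  finally have "bergman_integral p \<alpha> f \<le> ennreal ((\<alpha> + 1) / pi) * (ennreal pi * ennreal (2 powr (1 + \<alpha>) / (\<alpha> + 1)))"
    unfolding bergman_integral_eq[OF f p \<alpha>] by (rule mult_left_mono) simp
  also have "\<dots> = ennreal (2 powr (1 + \<alpha>))"
    using \<alpha> by (simp flip: ennreal_mult)
  finally show ?thesis .
qed

text \<open>The complex power is written with \<open>exp\<close> and the principal
  \<open>Ln\<close>, holomorphic because \<open>1 - cnj a * z\<close> has positive real part on the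
  disk. The exponents make \<open>norm (kernel_fun p \<alpha> a z) powr p\<close> equal to the
  majorant in \<open>bergman_integral_kernel_bound\<close>.\<close>

definition kernel_fun :: "real \<Rightarrow> real \<Rightarrow> complex \<Rightarrow> complex \<Rightarrow> complex" where
  "kernel_fun p \<alpha> a z =
    of_real ((1 - (norm a)\<^sup>2) powr (1 / p)) * exp (- of_real ((3 + \<alpha>) / p) * Ln (1 - cnj a * z))"

lemma kernel_fun_has_derivative:
  assumes a: "norm a < 1" and z: "norm z < 1"
  shows "(kernel_fun p \<alpha> a has_field_derivative
    of_real ((3 + \<alpha>) / p) * cnj a / (1 - cnj a * z) * kernel_fun p \<alpha> a z) (at z)"
proof -
  have "0 < Re (1 - cnj a * z)" using one_minus_cnj_mult_bounds[OF a, of z] z by simp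
  then have nz: "1 - cnj a * z \<notin> \<real>\<^sub>\<le>\<^sub>0" "1 - cnj a * z \<noteq> 0"
    unfolding complex_nonpos_Reals_iff by (linarith, metis less_irrefl zero_complex.sel(1))
  show ?thesis
    unfolding kernel_fun_def [abs_def]
    by (rule derivative_eq_intros refl nz)+ (use nz in \<open>simp add: field_simps\<close>)
qed

lemma norm_kernel_fun:
  assumes a: "norm a < 1" and z: "norm z < 1"
  shows "norm (kernel_fun p \<alpha> a z) =
    (1 - (norm a)\<^sup>2) powr (1 / p) * norm (1 - cnj a * z) powr - ((3 + \<alpha>) / p)"
proof -
  have "1 - cnj a * z \<noteq> 0" using one_minus_cnj_mult_bounds(3)[OF a, of z] z
    by (metis less_imp_le less_irrefl zero_complex.sel(1))
  then show ?thesis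
    by (simp add: kernel_fun_def norm_mult powr_def)
qed

text \<open>Since \<open>1 - cnj a * a = 1 - (norm a)\<^sup>2\<close>, the exponents
  \<open>1 / p\<close> and \<open>- (3 + \<alpha>) / p\<close> add up. At \<open>a\<close> the
  kernel thus has the largest growth that \<open>bergman_pointwise_bounds\<close> permits.\<close>

lemma norm_kernel_fun_self:
  assumes a: "norm a < 1"
  shows "norm (kernel_fun p \<alpha> a a) = (1 - (norm a)\<^sup>2) powr - ((2 + \<alpha>) / p)"
proof -
  have pos: "0 < 1 - (norm a)\<^sup>2" using a by (simp add: power_less_one_iff)
  have "1 - cnj a * a = of_real (1 - (norm a)\<^sup>2)"
    by (simp add: complex_norm_square mult.commute del: of_real_power)
  then have "norm (1 - cnj a * a) = 1 - (norm a)\<^sup>2" using pos by (metis norm_of_real abs_of_pos)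
  then show ?thesis
    using norm_kernel_fun[OF a a] by (simp add: diff_divide_distrib add_divide_distrib flip: powr_add)
qed

text \<open>The factor \<open>m\<close> lets one bound, independent of \<open>a\<close>, serve both
  test functions: \<open>m = 1\<close> and \<open>m\<close> the disk automorphism.\<close>

lemma kernel_fun_bergman:
  assumes p: "1 \<le> p" and \<alpha>: "-1 < \<alpha>" and a: "norm a < 1"
    and m: "m holomorphic_on ball 0 1" "\<And>z. norm z < 1 \<Longrightarrow> norm (m z) \<le> 1"
  shows "(\<lambda>z. m z * kernel_fun p \<alpha> a z) \<in> bergman_space p \<alpha>"
    "bergman_norm p \<alpha> (\<lambda>z. m z * kernel_fun p \<alpha> a z) \<le> 2 powr ((1 + \<alpha>) / p)"
proof -
  let ?f = "\<lambda>z. m z * kernel_fun p \<alpha> a z"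
  have pos: "0 < 1 - (norm a)\<^sup>2" using a by (simp add: power_less_one_iff)
  have "kernel_fun p \<alpha> a holomorphic_on ball 0 1"
    using kernel_fun_has_derivative[OF a]
    by (metis field_differentiable_def holomorphic_onI field_differentiable_at_within mem_ball_0)
  then have hol: "?f holomorphic_on ball 0 1" by (intro holomorphic_intros m)
  have I: "bergman_integral p \<alpha> ?f \<le> ennreal (2 powr (1 + \<alpha>))"
  proof (rule bergman_integral_kernel_bound[OF hol p \<alpha> a])
    fix z :: complex assume z: "norm z < 1"
    have "norm (?f z) \<le> 1 * norm (kernel_fun p \<alpha> a z)"
      unfolding norm_mult by (intro mult_right_mono m z) simp
    then have "norm (?f z) powr p \<le> norm (kernel_fun p \<alpha> a z) powr p"
      using p by (intro powr_mono2) auto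
    also have "\<dots> = (1 - (norm a)\<^sup>2) * norm (1 - cnj a * z) powr - (3 + \<alpha>)"
      using p pos by (simp add: norm_kernel_fun[OF a z] powr_mult powr_powr)
    finally show "norm (?f z) powr p \<le> (1 - (norm a)\<^sup>2) * norm (1 - cnj a * z) powr - (3 + \<alpha>)" .
  qed
  then have fin: "bergman_integral p \<alpha> ?f < \<infinity>" by (rule le_less_trans) simp
  with hol show "?f \<in> bergman_space p \<alpha>" by (simp add: bergman_space_def)
  have "enn2real (bergman_integral p \<alpha> ?f) \<le> 2 powr (1 + \<alpha>)"
    using I by (intro enn2real_leI) auto
  then have "bergman_norm p \<alpha> ?f \<le> (2 powr (1 + \<alpha>)) powr (1 / p)"
    unfolding bergman_norm_def using p by (intro powr_mono2) auto
  then show "bergman_norm p \<alpha> ?f \<le> 2 powr ((1 + \<alpha>) / p)" by (simp add: powr_powr)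
qed

section \<open>Growth conditions\<close>

text \<open>With \<open>x = 1 - r\<close>, one has \<open>r \<le> exp (- x)\<close>, and
  \<open>y \<le> exp y\<close> at \<open>y = j * x / q\<close>, raised to the power
  \<open>q\<close>, gives \<open>(j * x) powr q \<le> q powr q * exp (j * x)\<close>. The
  exponentials cancel; \<open>exp 1\<close> pays for the shift \<open>j - 1\<close> and
  \<open>2 powr q\<close> for \<open>1 - r\<^sup>2 \<le> 2 * x\<close>.\<close>

lemma powr_mult_power_le:
  fixes r q :: real
  assumes q: "0 < q" and r: "0 \<le> r" "r < 1" and j: "1 \<le> (j::nat)"
  shows "real j powr q * r ^ (j - 1) \<le> exp 1 * (2 * q) powr q * (1 - r\<^sup>2) powr - q"
proof -
  define x where "x = 1 - r"
  have x: "0 < x" "x \<le> 1" using r by (auto simp: x_def)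
  have "r \<le> exp (- x)" using exp_ge_add_one_self[of "- x"] by (simp add: x_def)
  then have "r ^ (j - 1) \<le> exp (- x) ^ (j - 1)" using r by (intro power_mono) auto
  also have "\<dots> = exp (x - real j * x)"
    using j by (simp add: of_nat_diff algebra_simps flip: exp_of_nat_mult)
  also have "\<dots> \<le> exp (1 - real j * x)" using x by simp
  finally have pow: "r ^ (j - 1) \<le> exp 1 * exp (- (real j * x))"
    by (simp add: exp_diff exp_minus field_simps)
  have "real j * x / q \<le> exp (real j * x / q)"
    using exp_ge_add_one_self[of "real j * x / q"] by linarith
  then have "(real j * x / q) powr q \<le> exp (real j * x / q) powr q"
    using x q by (intro powr_mono2) auto
  also have "\<dots> = exp (real j * x)" using q by (simp add: powr_def)
  finally have "real j powr q * x powr q \<le> q powr q * exp (real j * x)"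
    using q by (simp add: powr_divide powr_mult field_simps)
  then have "real j powr q \<le> q powr q * exp (real j * x) / x powr q"
    using x by (simp add: field_simps)
  with pow have "real j powr q * r ^ (j - 1)
    \<le> (q powr q * exp (real j * x) / x powr q) * (exp 1 * exp (- (real j * x)))"
    using r by (intro mult_mono) auto
  also have "\<dots> = exp 1 * q powr q * x powr - q"
    by (simp add: powr_minus exp_minus field_simps)
  also have "\<dots> \<le> exp 1 * q powr q * ((1 - r\<^sup>2) / 2) powr - q"
  proof (intro mult_left_mono powr_mono2')
    have "1 - r\<^sup>2 = (1 - r) * (1 + r)" by (simp add: power2_eq_square algebra_simps)
    also have "\<dots> \<le> (1 - r) * 2" using r by (intro mult_left_mono) auto
    finally show "(1 - r\<^sup>2) / 2 \<le> x" by (simp add: x_def)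
    show "0 < (1 - r\<^sup>2) / 2" using r by (simp add: power_less_one_iff)
  qed (use q in auto)
  also have "\<dots> = exp 1 * (2 * q) powr q * (1 - r\<^sup>2) powr - q"
    using q unfolding powr_divide powr_minus_divide by (simp add: powr_mult)
  finally show ?thesis .
qed

text \<open>The index \<open>\<lfloor>1 / (1 - r)\<rfloor>\<close> maximizes \<open>j\<^sup>q r\<^sup>j\<close> up to a constant factor.\<close>

lemma powr_le_powr_mult_power:
  fixes r q :: real
  assumes q: "0 < q" and r: "0 \<le> r" "r < 1"
  obtains j :: nat where "1 \<le> j"
    "(1 - r\<^sup>2) powr - q \<le> exp 1 * 2 powr q * (real j powr q * r ^ (j - 1))"
proof
  define y where "y = 1 / (1 - r)"
  define j where "j = nat \<lfloor>y\<rfloor>"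
  have y: "1 \<le> y" using r by (simp add: y_def)
  show j: "1 \<le> j" using y by (simp add: j_def le_nat_iff)
  have jy: "real j \<le> y" "y < real j + 1" using y by (auto simp: j_def)
  have "1 - r \<le> 1 - r\<^sup>2" using r by (simp add: power2_eq_square mult_left_le)
  then have "(1 - r\<^sup>2) powr - q \<le> (1 - r) powr - q" using r q by (intro powr_mono2') auto
  also have "\<dots> = y powr q" unfolding y_def powr_divide powr_minus_divide by simp
  also have "\<dots> \<le> (2 * real j) powr q"
  proof (intro powr_mono2)
    have "1 \<le> real j" using j by simp
    then show "y \<le> 2 * real j" using jy by linarith
  qed (use y q in auto)
  also have "\<dots> = 2 powr q * real j powr q" by (simp add: powr_mult)
  finally have 1: "(1 - r\<^sup>2) powr - q \<le> 2 powr q * real j powr q" .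
  \<comment> \<open>For this \<open>j\<close> the power has not yet decayed:
    \<open>j - 1 \<le> r / (1 - r)\<close> and \<open>- ln r \<le> (1 - r) / r\<close> have product
    at most 1. For \<open>r = 0\<close> the index is 1 and \<open>0 ^ 0 = 1\<close>.\<close>
  have 2: "1 \<le> exp 1 * r ^ (j - 1)"
  proof (cases "r = 0")
    case True
    then have "j = 1" by (simp add: j_def y_def)
    then show ?thesis by simp
  next
    case False
    then have r0: "0 < r" using r by simp
    have "real (j - 1) \<le> r / (1 - r)"
      using jy(1) j r by (simp add: y_def of_nat_diff field_simps)
    moreover have "1 - 1 / r \<le> ln r"
      using ln_le_minus_one[of "1 / r"] r0 by (simp add: ln_div)
    ultimately have "real (j - 1) * (- ln r) \<le> r / (1 - r) * (1 / r - 1)"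
      using r r0 by (intro mult_mono) auto
    also have "\<dots> = 1" using r r0 by (simp add: field_simps)
    finally have "0 \<le> 1 + real (j - 1) * ln r" by simp
    then have "exp 0 \<le> exp (1 + real (j - 1) * ln r)" by (simp only: exp_le_cancel_iff)
    also have "\<dots> = exp 1 * r ^ (j - 1)"
      using r0 by (simp add: exp_add exp_of_nat_mult)
    finally show ?thesis by simp
  qed
  have "(1 - r\<^sup>2) powr - q \<le> 2 powr q * real j powr q * (exp 1 * r ^ (j - 1))"
    using mult_mono[OF 1 2] by simp
  then show "(1 - r\<^sup>2) powr - q \<le> exp 1 * 2 powr q * (real j powr q * r ^ (j - 1))"
    by (simp add: mult_ac)
qed

text \<open>At each point the supremum over \<open>j\<close> is comparable to the negative power,
  with constants depending only on \<open>q\<close>. The index chosen in the forward direction may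
  vary with \<open>z\<close>, because \<open>M\<close> is uniform in both.\<close>

lemma bounded_powr_mult_power_iff:
  fixes K \<rho> :: "'a \<Rightarrow> real"
  assumes q: "0 < q" and K: "\<And>z. z \<in> S \<Longrightarrow> 0 \<le> K z"
    and \<rho>: "\<And>z. z \<in> S \<Longrightarrow> 0 \<le> \<rho> z" "\<And>z. z \<in> S \<Longrightarrow> \<rho> z < 1"
  shows "(\<exists>M. \<forall>j\<ge>1::nat. \<forall>z\<in>S. real j powr q * (K z * \<rho> z ^ (j - 1)) \<le> M) \<longleftrightarrow>
    (\<exists>M. \<forall>z\<in>S. K z * (1 - (\<rho> z)\<^sup>2) powr - q \<le> M)" (is "?L \<longleftrightarrow> ?R")
proof
  assume ?L
  then obtain M where M: "real j powr q * (K z * \<rho> z ^ (j - 1)) \<le> M" if "1 \<le> j" "z \<in> S" for j z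
    by blast
  have "K z * (1 - (\<rho> z)\<^sup>2) powr - q \<le> exp 1 * 2 powr q * M" if z: "z \<in> S" for z
  proof -
    obtain j where j: "1 \<le> j"
      "(1 - (\<rho> z)\<^sup>2) powr - q \<le> exp 1 * 2 powr q * (real j powr q * \<rho> z ^ (j - 1))"
      using powr_le_powr_mult_power[OF q \<rho>(1)[OF z] \<rho>(2)[OF z]] by blast
    from mult_left_mono[OF j(2) K[OF z]]
    have "K z * (1 - (\<rho> z)\<^sup>2) powr - q \<le> exp 1 * 2 powr q * (real j powr q * (K z * \<rho> z ^ (j - 1)))"
      by (simp add: mult_ac)
    also have "\<dots> \<le> exp 1 * 2 powr q * M" by (intro mult_left_mono M j z) auto
    finally show ?thesis .
  qed
  then show ?R by blast
next
  assume ?R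
  then obtain M where M: "K z * (1 - (\<rho> z)\<^sup>2) powr - q \<le> M" if "z \<in> S" for z
    by blast
  have "real j powr q * (K z * \<rho> z ^ (j - 1)) \<le> exp 1 * (2 * q) powr q * M" if j: "1 \<le> j" and z: "z \<in> S" for j z
  proof -
    from mult_left_mono[OF powr_mult_power_le[OF q \<rho>(1)[OF z] \<rho>(2)[OF z] j] K[OF z]]
    have "real j powr q * (K z * \<rho> z ^ (j - 1)) \<le> exp 1 * (2 * q) powr q * (K z * (1 - (\<rho> z)\<^sup>2) powr - q)"
      by (simp add: mult_ac)
    also have "\<dots> \<le> exp 1 * (2 * q) powr q * M" by (intro mult_left_mono M z) auto
    finally show ?thesis .
  qed
  then show ?L by blast
qed

lemma SUP_mult_SUP_ennreal_finite_iff: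
  fixes c :: "'a \<Rightarrow> real" and g :: "'a \<Rightarrow> 'b \<Rightarrow> real"
  assumes c: "\<And>j. j \<in> J \<Longrightarrow> 0 \<le> c j"
  shows "(SUP j\<in>J. ennreal (c j) * (SUP z\<in>S. ennreal (g j z))) < \<infinity> \<longleftrightarrow>
    (\<exists>M. \<forall>j\<in>J. \<forall>z\<in>S. c j * g j z \<le> M)" (is "?s < \<infinity> \<longleftrightarrow> _")
proof
  assume fin: "?s < \<infinity>"
  have "c j * g j z \<le> enn2real ?s" if "j \<in> J" "z \<in> S" for j z
  proof -
    have "ennreal (c j * g j z) = ennreal (c j) * ennreal (g j z)"
      using c that by (simp add: ennreal_mult')
    also have "\<dots> \<le> ennreal (c j) * (SUP z\<in>S. ennreal (g j z))"
      using that by (intro mult_left_mono SUP_upper) auto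
    also have "\<dots> \<le> ?s" using that by (intro SUP_upper)
    also have "\<dots> = ennreal (enn2real ?s)" using fin by simp
    finally show ?thesis by (simp only: ennreal_le_iff[OF enn2real_nonneg])
  qed
  then show "\<exists>M. \<forall>j\<in>J. \<forall>z\<in>S. c j * g j z \<le> M" by blast
next
  assume "\<exists>M. \<forall>j\<in>J. \<forall>z\<in>S. c j * g j z \<le> M"
  then obtain M where M: "\<And>j z. j \<in> J \<Longrightarrow> z \<in> S \<Longrightarrow> c j * g j z \<le> M" by blast
  have "?s \<le> ennreal M"
  proof (rule SUP_least)
    fix j assume j: "j \<in> J"
    show "ennreal (c j) * (SUP z\<in>S. ennreal (g j z)) \<le> ennreal M"
      unfolding SUP_mult_left_ennreal
      using c[OF j] M[OF j] by (intro SUP_least) (simp add: ennreal_leI flip: ennreal_mult')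
  qed
  then show "?s < \<infinity>" by (rule le_less_trans) simp
qed

section \<open>Bloch norms of primitives and derivatives of weighted compositions\<close>

text \<open>On the convex disk \<open>h\<close> has a primitive \<open>g\<close>, and the integral
  is \<open>g z - g 0\<close>. It vanishes at 0, so only the seminorm remains, and its derivative is
  \<open>h\<close>. This removes the integrals from \<open>I_op\<close> and
  \<open>J_op\<close>.\<close>

lemma bloch_norm_primitive:
  assumes h: "h holomorphic_on ball 0 1"
  shows "bloch_norm (\<lambda>z. contour_integral (linepath 0 z) h)
    = (SUP z\<in>ball 0 1. ennreal ((1 - (norm z)\<^sup>2) * norm (h z)))"
proof -
  let ?F = "\<lambda>z. contour_integral (linepath 0 z) h"
  obtain g where g: "\<And>z. z \<in> ball 0 1 \<Longrightarrow> (g has_field_derivative h z) (at z within ball 0 1)"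
    using holomorphic_convex_primitive'[OF convex_ball open_ball h] by blast
  have F: "?F z = g z - g 0" if "z \<in> ball 0 1" for z
  proof -
    have "path_image (linepath 0 z) \<subseteq> ball 0 1"
      using that by (simp only: path_image_linepath) (intro closed_segment_subset, auto)
    then show ?thesis
      using contour_integral_primitive[OF g valid_path_linepath]
      by (intro contour_integral_unique) fastforce
  qed
  have "deriv ?F z = h z" if z: "z \<in> ball 0 1" for z
  proof (rule DERIV_imp_deriv)
    have "(g has_field_derivative h z) (at z)"
      using g[OF z] by (simp only: at_within_open[OF z open_ball])
    then have "((\<lambda>z. g z - g 0) has_field_derivative h z) (at z)"
      by (auto intro!: derivative_eq_intros)
    \<comment> \<open>The identity with \<open>g\<close> is known only on the disk, so the
      derivative is transferred through a neighbourhood of \<open>z\<close>.\<close>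
    then show "(?F has_field_derivative h z) (at z)"
      by (rule DERIV_cong_ev[THEN iffD1, rotated -1])
        (auto intro!: eventually_mono[OF eventually_nhds_in_open[OF open_ball z]] simp del: mem_ball simp: F)
  qed
  then show ?thesis by (simp add: bloch_norm_def bloch_seminorm_def)
qed

lemma bloch_norm_le_imp:
  assumes "bloch_norm g \<le> ennreal B" "0 \<le> B" "norm z < 1"
  shows "(1 - (norm z)\<^sup>2) * norm (deriv g z) \<le> B"
proof -
  have "ennreal ((1 - (norm z)\<^sup>2) * norm (deriv g z)) \<le> bloch_seminorm g"
    unfolding bloch_seminorm_def using assms by (intro SUP_upper) simp
  also have "\<dots> \<le> bloch_norm g" by (simp add: bloch_norm_def)
  also have "\<dots> \<le> ennreal B" by (rule assms)
  finally show ?thesis using assms(2) by (simp only: ennreal_le_iff)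
qed

lemma weighted_comp_has_derivative:
  assumes u: "u holomorphic_on ball 0 1" and \<phi>: "\<phi> holomorphic_on ball 0 1"
    and z: "norm z < 1" and f: "(f has_field_derivative d) (at (\<phi> z))"
  shows "(weighted_comp u \<phi> f has_field_derivative deriv u z * f (\<phi> z) + u z * (d * deriv \<phi> z)) (at z)"
proof -
  have "(u has_field_derivative deriv u z) (at z)" "(\<phi> has_field_derivative deriv \<phi> z) (at z)"
    by (rule holomorphic_derivI[OF u open_ball] holomorphic_derivI[OF \<phi> open_ball], use z in simp)+
  from DERIV_mult[OF this(1) DERIV_chain2[OF f this(2)]] show ?thesis
    unfolding weighted_comp_def by (simp add: mult_ac)
qed

text \<open>Differentiating \<open>\<phi> z ^ j\<close> brings a factor \<open>j\<close>, absorbed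
  into \<open>j powr (q + 1)\<close>, and leaves the power \<open>j - 1\<close>; hence the exponent
  \<open>q + 1\<close> on the right.\<close>

lemma SUP_bloch_norm_I_op_finite_iff:
  assumes q: "0 < q" and u: "u holomorphic_on ball 0 1"
    and \<phi>: "\<phi> holomorphic_on ball 0 1" "\<phi> ` ball 0 1 \<subseteq> ball 0 1"
  shows "(SUP j\<in>{1::nat..}. ennreal (real j powr q) * bloch_norm (I_op u (\<lambda>z. \<phi> z ^ j))) < \<infinity> \<longleftrightarrow>
    (\<exists>M. \<forall>z\<in>ball 0 1. (1 - (norm z)\<^sup>2) * norm (deriv \<phi> z * u z) * (1 - (norm (\<phi> z))\<^sup>2) powr - (q + 1) \<le> M)"
proof -
  have d: "deriv (\<lambda>z. \<phi> z ^ j) z = of_nat j * \<phi> z ^ (j - 1) * deriv \<phi> z" if "z \<in> ball 0 1" for j z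
    using DERIV_power[OF holomorphic_derivI[OF \<phi>(1) open_ball that], of j]
    by (intro DERIV_imp_deriv) (simp add: mult_ac)
  have I: "bloch_norm (I_op u (\<lambda>z. \<phi> z ^ j))
    = (SUP z\<in>ball 0 1. ennreal ((1 - (norm z)\<^sup>2) * norm (deriv (\<lambda>z. \<phi> z ^ j) z * u z)))" for j
    unfolding I_op_def
    by (intro bloch_norm_primitive holomorphic_intros u \<phi>) simp
  have eq: "real j powr q * ((1 - (norm z)\<^sup>2) * norm (deriv (\<lambda>z. \<phi> z ^ j) z * u z))
    = real j powr (q + 1) * ((1 - (norm z)\<^sup>2) * norm (deriv \<phi> z * u z) * norm (\<phi> z) ^ (j - 1))"
    if "z \<in> ball 0 1" for j z
    unfolding d[OF that] by (simp add: powr_add norm_mult norm_power)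
  have "(SUP j\<in>{1::nat..}. ennreal (real j powr q) * bloch_norm (I_op u (\<lambda>z. \<phi> z ^ j))) < \<infinity> \<longleftrightarrow>
    (\<exists>M. \<forall>j\<in>{1::nat..}. \<forall>z\<in>ball 0 1. real j powr q * ((1 - (norm z)\<^sup>2) * norm (deriv (\<lambda>z. \<phi> z ^ j) z * u z)) \<le> M)"
    unfolding I by (rule SUP_mult_SUP_ennreal_finite_iff) simp
  also have "\<dots> \<longleftrightarrow> (\<exists>M. \<forall>j\<ge>1::nat. \<forall>z\<in>ball 0 1.
      real j powr (q + 1) * ((1 - (norm z)\<^sup>2) * norm (deriv \<phi> z * u z) * norm (\<phi> z) ^ (j - 1)) \<le> M)"
    by (simp only: eq atLeast_iff Ball_def cong: imp_cong)
  also have "\<dots> \<longleftrightarrow> (\<exists>M. \<forall>z\<in>ball 0 1.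
      (1 - (norm z)\<^sup>2) * norm (deriv \<phi> z * u z) * (1 - (norm (\<phi> z))\<^sup>2) powr - (q + 1) \<le> M)"
    using q \<phi>(2) by (intro bounded_powr_mult_power_iff) (auto simp: power_le_one image_subset_iff)
  finally show ?thesis .
qed

text \<open>No power of \<open>\<phi>\<close> is differentiated, so the exponent stays
  \<open>q\<close>; the power \<open>j - 1\<close> already fits
  \<open>bounded_powr_mult_power_iff\<close>.\<close>

lemma SUP_bloch_norm_J_op_finite_iff:
  assumes q: "0 < q" and u: "u holomorphic_on ball 0 1"
    and \<phi>: "\<phi> holomorphic_on ball 0 1" "\<phi> ` ball 0 1 \<subseteq> ball 0 1"
  shows "(SUP j\<in>{1::nat..}. ennreal (real j powr q) * bloch_norm (J_op u (\<lambda>z. \<phi> z ^ (j - 1)))) < \<infinity> \<longleftrightarrow>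
    (\<exists>M. \<forall>z\<in>ball 0 1. (1 - (norm z)\<^sup>2) * norm (deriv u z) * (1 - (norm (\<phi> z))\<^sup>2) powr - q \<le> M)"
proof -
  have J: "bloch_norm (J_op u (\<lambda>z. \<phi> z ^ (j - 1)))
    = (SUP z\<in>ball 0 1. ennreal ((1 - (norm z)\<^sup>2) * norm (\<phi> z ^ (j - 1) * deriv u z)))" for j
    unfolding J_op_def
    by (intro bloch_norm_primitive holomorphic_intros u \<phi>) simp
  have "(SUP j\<in>{1::nat..}. ennreal (real j powr q) * bloch_norm (J_op u (\<lambda>z. \<phi> z ^ (j - 1)))) < \<infinity> \<longleftrightarrow>
    (\<exists>M. \<forall>j\<in>{1::nat..}. \<forall>z\<in>ball 0 1. real j powr q * ((1 - (norm z)\<^sup>2) * norm (\<phi> z ^ (j - 1) * deriv u z)) \<le> M)"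
    unfolding J by (rule SUP_mult_SUP_ennreal_finite_iff) simp
  also have "\<dots> \<longleftrightarrow> (\<exists>M. \<forall>j\<ge>1::nat. \<forall>z\<in>ball 0 1.
      real j powr q * ((1 - (norm z)\<^sup>2) * norm (deriv u z) * norm (\<phi> z) ^ (j - 1)) \<le> M)"
    by (simp add: norm_mult norm_power mult_ac Ball_def)
  also have "\<dots> \<longleftrightarrow> (\<exists>M. \<forall>z\<in>ball 0 1.
      (1 - (norm z)\<^sup>2) * norm (deriv u z) * (1 - (norm (\<phi> z))\<^sup>2) powr - q \<le> M)"
    using q \<phi>(2) by (intro bounded_powr_mult_power_iff) (auto simp: power_le_one image_subset_iff)
  finally show ?thesis .
qed

section \<open>Necessity of the growth conditions\<close>

text \<open>The test functions change with \<open>z\<close>, but their norms are bounded uniformly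
  in \<open>a = \<phi> z\<close>, so \<open>M\<close> does not depend on \<open>z\<close>. The bound
  on \<open>deriv \<phi> z * u z\<close> comes first and then controls the error term in the bound
  on \<open>deriv u z\<close>.\<close>

lemma weighted_comp_bounded_imp:
  assumes p: "1 \<le> p" and \<alpha>: "-1 < \<alpha>" and u: "u holomorphic_on ball 0 1"
    and \<phi>: "\<phi> holomorphic_on ball 0 1" "\<phi> ` ball 0 1 \<subseteq> ball 0 1"
    and bdd: "bounded_bergman_bloch p \<alpha> (weighted_comp u \<phi>)"
  defines "\<gamma> \<equiv> (2 + \<alpha>) / p"
  obtains M where "\<And>z. z \<in> ball 0 1 \<Longrightarrow>
      (1 - (norm z)\<^sup>2) * norm (deriv \<phi> z * u z) * (1 - (norm (\<phi> z))\<^sup>2) powr - (\<gamma> + 1) \<le> M"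
    "\<And>z. z \<in> ball 0 1 \<Longrightarrow>
      (1 - (norm z)\<^sup>2) * norm (deriv u z) * (1 - (norm (\<phi> z))\<^sup>2) powr - \<gamma> \<le> M"
proof -
  obtain C where C: "0 \<le> C"
    "\<And>f. f \<in> bergman_space p \<alpha> \<Longrightarrow> bloch_norm (weighted_comp u \<phi> f) \<le> ennreal (C * bergman_norm p \<alpha> f)"
    using bdd unfolding bounded_bergman_bloch_def by blast
  define B where "B = C * 2 powr ((1 + \<alpha>) / p)"
  have B: "0 \<le> B" using C by (simp add: B_def)
  define s where "s = (3 + \<alpha>) / p"
  have s: "0 < s" using p \<alpha> by (simp add: s_def)
  have main: "(1 - (norm z)\<^sup>2) * norm (deriv \<phi> z * u z) * (1 - (norm (\<phi> z))\<^sup>2) powr - (\<gamma> + 1) \<le> B"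
      "(1 - (norm z)\<^sup>2) * norm (deriv u z) * (1 - (norm (\<phi> z))\<^sup>2) powr - \<gamma> \<le> B + s * B"
    if z: "z \<in> ball 0 1" for z
  proof -
    define a where "a = \<phi> z"
    define D where "D = 1 - (norm a)\<^sup>2"
    define w where "w = 1 - (norm z)\<^sup>2"
    define k where "k = kernel_fun p \<alpha> a"
    have z1: "norm z < 1" using z by simp
    have a: "norm a < 1" using z \<phi>(2) by (auto simp: a_def image_subset_iff)
    have D: "0 < D" using a by (simp add: D_def power_less_one_iff)
    have w: "0 \<le> w" using z1 by (simp add: w_def power_le_one)
    have Da: "1 - cnj a * a = of_real D"
      by (simp add: D_def complex_norm_square mult.commute del: of_real_power)
    have nk: "norm (k a) = D powr - \<gamma>"
      using norm_kernel_fun_self[OF a] by (simp add: k_def D_def \<gamma>_def)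
    have Dpow: "D powr - (\<gamma> + 1) = D powr - \<gamma> / D"
      unfolding powr_minus_divide using D by (simp add: powr_add)
    have dk: "(k has_field_derivative of_real s * cnj a / of_real D * k a) (at a)"
      using kernel_fun_has_derivative[OF a a] unfolding k_def s_def Da .
    have test: "w * norm (deriv u z * (m a * k a) + u z * (d * deriv \<phi> z)) \<le> B"
      if m: "m holomorphic_on ball 0 1" "\<And>z. norm z < 1 \<Longrightarrow> norm (m z) \<le> 1"
        and d: "((\<lambda>z. m z * k z) has_field_derivative d) (at a)" for m d
    proof -
      have "bloch_norm (weighted_comp u \<phi> (\<lambda>z. m z * k z)) \<le> ennreal (C * bergman_norm p \<alpha> (\<lambda>z. m z * k z))"
        unfolding k_def by (intro C kernel_fun_bergman p \<alpha> a m)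
      also have "\<dots> \<le> ennreal B"
        unfolding B_def k_def by (intro ennreal_leI mult_left_mono kernel_fun_bergman C p \<alpha> a m)
      finally have "w * norm (deriv (weighted_comp u \<phi> (\<lambda>z. m z * k z)) z) \<le> B"
        unfolding w_def by (rule bloch_norm_le_imp[OF _ B z1])
      moreover have "deriv (weighted_comp u \<phi> (\<lambda>z. m z * k z)) z
          = deriv u z * (m a * k a) + u z * (d * deriv \<phi> z)"
        using weighted_comp_has_derivative[OF u \<phi>(1) z1, of "\<lambda>z. m z * k z" d] d
        by (intro DERIV_imp_deriv) (simp add: a_def)
      ultimately show ?thesis by simp
    qed
    let ?m = "Moebius_function 0 a"
    \<comment> \<open>The automorphism vanishes at \<open>a\<close> with derivative
      \<open>1 / D\<close>, so the product rule loses the term with the derivative of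
      \<open>k\<close>.\<close>
    have dm: "((\<lambda>z. ?m z * k z) has_field_derivative k a / of_real D) (at a)"
    proof -
      have "(?m has_field_derivative 1 / of_real D) (at a)"
      proof -
        have nz: "1 - cnj a * a \<noteq> 0" using D Da by simp
        have "((\<lambda>z. z - a) has_field_derivative 1) (at a)"
          "((\<lambda>z. 1 - cnj a * z) has_field_derivative - cnj a) (at a)"
          by (auto intro!: derivative_eq_intros)
        from DERIV_divide[OF this nz] show ?thesis
          unfolding Moebius_function_simple [abs_def] Da using D by simp
      qed
      from DERIV_mult[OF this dk] show ?thesis
        by (simp add: Moebius_function_simple)
    qed
    \<comment> \<open>The \<open>deriv u z\<close> term carries the factor \<open>?m a = 0\<close>,
      and \<open>k a / D\<close> has modulus \<open>D powr - (\<gamma> + 1)\<close>.\<close>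
    have "w * norm (deriv u z * (?m a * k a) + u z * (k a / of_real D * deriv \<phi> z)) \<le> B"
      by (rule test[OF Moebius_function_holomorphic[OF a] _ dm])
        (rule less_imp_le[OF Moebius_function_norm_lt_1[OF a]])
    then have 1: "w * norm (deriv \<phi> z * u z) * D powr - (\<gamma> + 1) \<le> B"
      unfolding Dpow using D by (simp add: Moebius_function_simple norm_mult norm_divide nk mult_ac)
    then show "(1 - (norm z)\<^sup>2) * norm (deriv \<phi> z * u z) * (1 - (norm (\<phi> z))\<^sup>2) powr - (\<gamma> + 1) \<le> B"
      by (simp only: w_def D_def a_def)
    \<comment> \<open>For \<open>m = 1\<close> both terms survive: \<open>?X\<close> is the one
      wanted, \<open>?Y\<close> comes from the derivative of \<open>k\<close>. Fact \<open>1\<close>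
      bounds \<open>?Y\<close> at the cost of the factor \<open>s\<close>, and the triangle
      inequality isolates \<open>?X\<close>.\<close>
    let ?X = "deriv u z * k a" and ?Y = "u z * (of_real s * cnj a / of_real D * k a * deriv \<phi> z)"
    have "w * norm (?X + ?Y) \<le> B"
    proof -
      have "w * norm (deriv u z * k a + u z * (d * deriv \<phi> z)) \<le> B"
        if "(k has_field_derivative d) (at a)" for d
        using test[of "\<lambda>_. 1" d] that by simp
      from this[OF dk] show ?thesis .
    qed
    moreover have "w * norm ?Y \<le> s * B"
    proof -
      have "w * norm ?Y = (s * norm a) * (w * norm (deriv \<phi> z * u z) * D powr - (\<gamma> + 1))"
        unfolding Dpow using D s by (simp add: norm_mult norm_divide nk mult_ac)
      also have "\<dots> \<le> (s * 1) * B"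
        using a s w 1 by (intro mult_mono) auto
      finally show ?thesis by simp
    qed
    moreover have "w * norm ?X \<le> w * norm (?X + ?Y) + w * norm ?Y"
      unfolding distrib_left[symmetric] using w norm_triangle_ineq4[of "?X + ?Y" ?Y]
      by (intro mult_left_mono) auto
    ultimately have "w * norm ?X \<le> B + s * B" by linarith
    then have "w * norm (deriv u z) * D powr - \<gamma> \<le> B + s * B"
      by (simp add: norm_mult nk mult_ac)
    then show "(1 - (norm z)\<^sup>2) * norm (deriv u z) * (1 - (norm (\<phi> z))\<^sup>2) powr - \<gamma> \<le> B + s * B"
      by (simp only: w_def D_def a_def)
  qed
  have "B \<le> B + s * B" using B s by simp
  with main show thesis by (intro that[of "B + s * B"]) (blast intro: order_trans)+
qed

section \<open>Sufficiency of the growth conditions\<close>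

text \<open>The product rule splits the derivative into a term with \<open>f (\<phi> z)\<close> and
  one with \<open>deriv f (\<phi> z)\<close>. The pointwise estimates bound these by exactly the
  negative powers that appear in the hypotheses with \<open>M'\<close> and \<open>M\<close>.\<close>

lemma weighted_comp_boundedI:
  assumes p: "1 \<le> p" and \<alpha>: "-1 < \<alpha>" and u: "u holomorphic_on ball 0 1"
    and \<phi>: "\<phi> holomorphic_on ball 0 1" "\<phi> ` ball 0 1 \<subseteq> ball 0 1"
  defines "\<gamma> \<equiv> (2 + \<alpha>) / p"
  assumes M: "\<And>z. z \<in> ball 0 1 \<Longrightarrow>
      (1 - (norm z)\<^sup>2) * norm (deriv \<phi> z * u z) * (1 - (norm (\<phi> z))\<^sup>2) powr - (\<gamma> + 1) \<le> M"
    and M': "\<And>z. z \<in> ball 0 1 \<Longrightarrow>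
      (1 - (norm z)\<^sup>2) * norm (deriv u z) * (1 - (norm (\<phi> z))\<^sup>2) powr - \<gamma> \<le> M'"
  shows "bounded_bergman_bloch p \<alpha> (weighted_comp u \<phi>)"
proof -
  obtain C where C: "0 \<le> C"
    "\<And>f w. f \<in> bergman_space p \<alpha> \<Longrightarrow> norm w < 1 \<Longrightarrow>
      norm (f w) \<le> C * bergman_norm p \<alpha> f * (1 - (norm w)\<^sup>2) powr - \<gamma>"
    "\<And>f w. f \<in> bergman_space p \<alpha> \<Longrightarrow> norm w < 1 \<Longrightarrow>
      norm (deriv f w) \<le> C * bergman_norm p \<alpha> f * (1 - (norm w)\<^sup>2) powr - (\<gamma> + 1)"
    using bergman_pointwise_bounds[OF p \<alpha>] unfolding \<gamma>_def by blast
  \<comment> \<open>\<open>K\<close> controls the value at 0 in the Bloch norm, namely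
    \<open>u 0 * f (\<phi> 0)\<close>, by point evaluation at \<open>\<phi> 0\<close>.\<close>
  define K where "K = norm (u 0) * C * (1 - (norm (\<phi> 0))\<^sup>2) powr - \<gamma>"
  have K: "0 \<le> K" using C by (simp add: K_def)
  have MM: "0 \<le> M" "0 \<le> M'"
    using order_trans[OF _ M[of 0]] order_trans[OF _ M'[of 0]] by auto
  define L where "L = C * (M' + M)"
  have L: "0 \<le> L" using C MM by (simp add: L_def)
  have main: "weighted_comp u \<phi> f holomorphic_on ball 0 1"
      "bloch_seminorm (weighted_comp u \<phi> f) \<le> ennreal (L * bergman_norm p \<alpha> f)"
      "norm (weighted_comp u \<phi> f 0) \<le> K * bergman_norm p \<alpha> f"
    if f: "f \<in> bergman_space p \<alpha>" for f
  proof -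
    define N where "N = bergman_norm p \<alpha> f"
    have N: "0 \<le> N" by (simp add: N_def bergman_norm_def)
    have hol: "f holomorphic_on ball 0 1" using f by (simp add: bergman_space_def)
    show "weighted_comp u \<phi> f holomorphic_on ball 0 1"
      unfolding weighted_comp_def
      using holomorphic_on_compose_gen[OF \<phi>(1) hol \<phi>(2)] u
      by (intro holomorphic_intros) (auto simp: o_def)
    have ball: "norm (\<phi> z) < 1" if "z \<in> ball 0 1" for z using that \<phi>(2) by (auto simp: image_subset_iff)
    show "norm (weighted_comp u \<phi> f 0) \<le> K * bergman_norm p \<alpha> f"
      using mult_left_mono[OF C(2)[OF f ball[of 0]], of "norm (u 0)"]
      by (simp add: weighted_comp_def norm_mult K_def mult_ac)
    have "(1 - (norm z)\<^sup>2) * norm (deriv (weighted_comp u \<phi> f) z) \<le> L * N" if z: "z \<in> ball 0 1" for z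
    proof -
      define D where "D = 1 - (norm (\<phi> z))\<^sup>2"
      define w where "w = 1 - (norm z)\<^sup>2"
      have w: "0 \<le> w" using z by (simp add: w_def power_le_one)
      have "(f has_field_derivative deriv f (\<phi> z)) (at (\<phi> z))"
        by (rule holomorphic_derivI[OF hol open_ball]) (use ball[OF z] in simp)
      then have d: "deriv (weighted_comp u \<phi> f) z = deriv u z * f (\<phi> z) + u z * (deriv f (\<phi> z) * deriv \<phi> z)"
        using z by (intro DERIV_imp_deriv weighted_comp_has_derivative u \<phi>) auto
      have "norm (deriv (weighted_comp u \<phi> f) z)
        \<le> norm (deriv u z) * norm (f (\<phi> z)) + norm (deriv \<phi> z * u z) * norm (deriv f (\<phi> z))"
        unfolding d by (rule order_trans[OF norm_triangle_ineq]) (simp add: norm_mult mult_ac)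
      also have "\<dots> \<le> norm (deriv u z) * (C * N * D powr - \<gamma>) + norm (deriv \<phi> z * u z) * (C * N * D powr - (\<gamma> + 1))"
        unfolding N_def D_def by (intro add_mono mult_left_mono C f ball z) auto
      finally have "w * norm (deriv (weighted_comp u \<phi> f) z) \<le> w *
        (norm (deriv u z) * (C * N * D powr - \<gamma>) + norm (deriv \<phi> z * u z) * (C * N * D powr - (\<gamma> + 1)))"
        using w by (rule mult_left_mono)
      also have "\<dots> = C * N * (w * norm (deriv u z) * D powr - \<gamma> + w * norm (deriv \<phi> z * u z) * D powr - (\<gamma> + 1))"
        by (simp add: algebra_simps)
      also have "\<dots> \<le> C * N * (M' + M)"
        using C N unfolding w_def D_def by (intro mult_left_mono add_mono M M' z) auto
      finally show ?thesis by (simp add: w_def L_def mult_ac)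
    qed
    then show "bloch_seminorm (weighted_comp u \<phi> f) \<le> ennreal (L * bergman_norm p \<alpha> f)"
      unfolding bloch_seminorm_def N_def by (intro SUP_least ennreal_leI)
  qed
  have "weighted_comp u \<phi> f \<in> bloch_space" if f: "f \<in> bergman_space p \<alpha>" for f
    using main(1)[OF f] le_less_trans[OF main(2)[OF f]] by (simp add: bloch_space_def)
  moreover have "bloch_norm (weighted_comp u \<phi> f) \<le> ennreal ((K + L) * bergman_norm p \<alpha> f)"
    if f: "f \<in> bergman_space p \<alpha>" for f
  proof -
    have "bloch_norm (weighted_comp u \<phi> f) \<le> ennreal (K * bergman_norm p \<alpha> f) + ennreal (L * bergman_norm p \<alpha> f)"
      unfolding bloch_norm_def by (intro add_mono ennreal_leI main f)
    also have "\<dots> = ennreal ((K + L) * bergman_norm p \<alpha> f)"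
      using K L by (simp add: bergman_norm_def distrib_right flip: ennreal_plus)
    finally show ?thesis .
  qed
  moreover have "0 \<le> K + L" using K L by simp
  ultimately show ?thesis unfolding bounded_bergman_bloch_def by blast
qed

theorem theorem3p1:
  fixes p \<alpha> :: real and u \<phi> :: "complex \<Rightarrow> complex"
  assumes "1 \<le> p" and "\<alpha> > -1"
    and "u holomorphic_on ball 0 1"
    and "\<phi> holomorphic_on ball 0 1" and "\<phi> ` ball 0 1 \<subseteq> ball 0 1"
  shows "bounded_bergman_bloch p \<alpha> (weighted_comp u \<phi>) \<longleftrightarrow>
    (SUP j\<in>{1::nat..}. ennreal (real j powr ((2 + \<alpha>) / p)) * bloch_norm (I_op u (\<lambda>z. \<phi> z ^ j))) < \<infinity> \<and>
    (SUP j\<in>{1::nat..}. ennreal (real j powr ((2 + \<alpha>) / p)) * bloch_norm (J_op u (\<lambda>z. \<phi> z ^ (j - 1)))) < \<infinity>"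
proof -
  have "0 < (2 + \<alpha>) / p" using assms by simp
  note iffs = SUP_bloch_norm_I_op_finite_iff[OF this assms(3-5)] SUP_bloch_norm_J_op_finite_iff[OF this assms(3-5)]
  show ?thesis
    unfolding iffs
    using weighted_comp_bounded_imp[OF assms] weighted_comp_boundedI[OF assms] by metis
qed

end
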